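(* Let $G$ be a countable discrete group. If $G$ is residually finite and has character rigidity, then $G$ has the approximation property $(\ast)$: every embeddable character of $G$ is a pointwise limit of traces of finite-dimensional representations of $G$.
   Context: A character of $G$ is a positive definite function $\tau:G\to\mathbb C$ that is constant on conjugacy classes and satisfies $\tau(e)=1$. The characters form a convex set; extremal characters are its extreme points. The trace of a finite-dimensional (unitary) representation $\pi:G\to\mathcal U(M_n(\mathbb C))$ is the function $g\mapsto tr_n(\pi(g))$, where $tr_n$ is the normalized trace on $M_n(\mathbb C)$. A character is induced from the center if it vanishes outside the center $Z(G)$. $G$ has character rigidity if the only extremal characters of $G$ which are not induced from the center are the traces of finite-dimensional representations. $G$ is residually finite if homomorphisms to finite groups separate its points. An ultrafilter $\alpha$ on $\mathbb N$ is nontrivial if it contains a sequence of sets $E_n$ with $\bigcap_n E_n=\varnothing$. The tracial ultraproduct $\prod_{n\in\mathbb N}^{\alpha}(M_n(\mathbb C),tr_n)$ is the quotient of the $C^*$-algebra of norm-bounded sequences $(a_n)$, $a_n\in M_n(\mathbb C)$ (supremum norm), by the ideal of those with $\lim_{n\to\alpha}tr_n(a_n^*a_n)=0$; the coset of $(a_n)$ is $\{a_n\}_\alpha$, and $\tau_\alpha(\{a_n\}_\alpha)=\lim_{n\to\alpha}tr_n(a_n)$. A character $\tau$ is embeddable if there are a nontrivial ultrafilter $\alpha$ on $\mathbb N$ and a homomorphism $f$ from $G$ to the unitary group of $\prod_{n\in\mathbb N}^{\alpha}(M_n(\mathbb C),tr_n)$ with $\tau=\tau_\alpha\circ f$. 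*)

theory Defs
  imports
    Complex_Main
    "HOL-Library.Countable_Set"
    "HOL-Library.Nonpos_Ints"
    "HOL-Algebra.QuotRing"
    "Jordan_Normal_Form.Schur_Decomposition"
begin

subsection \<open>Characters\<close>

text \<open>Functions on a group \<open>G\<close> are total HOL functions of which only the values on
  \<open>carrier G\<close> matter; accordingly, equality of such functions always means equality
  on \<open>carrier G\<close>.\<close>

definition positive_definite :: "('a, 'b) monoid_scheme \<Rightarrow> ('a \<Rightarrow> complex) \<Rightarrow> bool" where
  "positive_definite G \<tau> \<longleftrightarrow>
     (\<forall>(n::nat) (x :: nat \<Rightarrow> 'a) (c :: nat \<Rightarrow> complex). (\<forall>i<n. x i \<in> carrier G) \<longrightarrow>
        (\<Sum>i<n. \<Sum>j<n. cnj (c i) * c j * \<tau> (inv\<^bsub>G\<^esub> (x i) \<otimes>\<^bsub>G\<^esub> x j)) \<in> \<real>\<^sub>\<ge>\<^sub>0)"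

definition group_character :: "('a, 'b) monoid_scheme \<Rightarrow> ('a \<Rightarrow> complex) \<Rightarrow> bool" where
  "group_character G \<tau> \<longleftrightarrow>
     positive_definite G \<tau> \<and>
     (\<forall>g\<in>carrier G. \<forall>h\<in>carrier G. \<tau> (h \<otimes>\<^bsub>G\<^esub> g \<otimes>\<^bsub>G\<^esub> inv\<^bsub>G\<^esub> h) = \<tau> g) \<and>
     \<tau> \<one>\<^bsub>G\<^esub> = 1"

definition extremal_character :: "('a, 'b) monoid_scheme \<Rightarrow> ('a \<Rightarrow> complex) \<Rightarrow> bool" where
  "extremal_character G \<tau> \<longleftrightarrow>
     group_character G \<tau> \<and>
     (\<forall>\<sigma>\<^sub>1 \<sigma>\<^sub>2 (t::real).
        group_character G \<sigma>\<^sub>1 \<and> group_character G \<sigma>\<^sub>2 \<and> 0 < t \<and> t < 1 \<and>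
        (\<forall>g\<in>carrier G. \<tau> g = of_real t * \<sigma>\<^sub>1 g + of_real (1 - t) * \<sigma>\<^sub>2 g) \<longrightarrow>
        (\<forall>g\<in>carrier G. \<sigma>\<^sub>1 g = \<tau> g \<and> \<sigma>\<^sub>2 g = \<tau> g))"

definition group_center :: "('a, 'b) monoid_scheme \<Rightarrow> 'a set" where
  "group_center G = {z \<in> carrier G. \<forall>g\<in>carrier G. z \<otimes>\<^bsub>G\<^esub> g = g \<otimes>\<^bsub>G\<^esub> z}"

definition induced_from_center :: "('a, 'b) monoid_scheme \<Rightarrow> ('a \<Rightarrow> complex) \<Rightarrow> bool" where
  "induced_from_center G \<tau> \<longleftrightarrow> (\<forall>g \<in> carrier G - group_center G. \<tau> g = 0)"

subsection \<open>Traces of finite-dimensional unitary representations\<close>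

definition unitary_group :: "('a, 'b) ring_scheme \<Rightarrow> ('a \<Rightarrow> 'a) \<Rightarrow> 'a monoid" where
  "unitary_group R star =
     \<lparr>carrier = {u \<in> carrier R. star u \<in> carrier R \<and>
                   star u \<otimes>\<^bsub>R\<^esub> u = \<one>\<^bsub>R\<^esub> \<and> u \<otimes>\<^bsub>R\<^esub> star u = \<one>\<^bsub>R\<^esub>},
      monoid.mult = (\<otimes>\<^bsub>R\<^esub>), one = \<one>\<^bsub>R\<^esub>\<rparr>"

definition normalized_trace :: "complex mat \<Rightarrow> complex" where
  "normalized_trace A = (\<Sum>i<dim_row A. A $$ (i, i)) / of_nat (dim_row A)"

definition trace_of_fd_rep :: "('a, 'b) monoid_scheme \<Rightarrow> ('a \<Rightarrow> complex) \<Rightarrow> bool" where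
  "trace_of_fd_rep G \<tau> \<longleftrightarrow>
     (\<exists>n\<ge>1. \<exists>\<pi> \<in> hom G (unitary_group (ring_mat TYPE(complex) n ()) mat_adjoint).
        \<forall>g\<in>carrier G. \<tau> g = normalized_trace (\<pi> g))"

definition character_rigidity :: "('a, 'b) monoid_scheme \<Rightarrow> bool" where
  "character_rigidity G \<longleftrightarrow>
     (\<forall>\<tau>. extremal_character G \<tau> \<and> \<not> induced_from_center G \<tau> \<longrightarrow> trace_of_fd_rep G \<tau>)"

subsection \<open>Residual finiteness\<close>

text \<open>Taking the finite groups to live on the type \<^typ>\<open>nat\<close> loses nothing, since every
  finite group is isomorphic to one on a set of natural numbers.\<close>

definition residually_finite :: "('a, 'b) monoid_scheme \<Rightarrow> bool" where
  "residually_finite G \<longleftrightarrow>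
     (\<forall>x\<in>carrier G. \<forall>y\<in>carrier G. x \<noteq> y \<longrightarrow>
        (\<exists>(H :: nat monoid) \<phi>. group H \<and> finite (carrier H) \<and> \<phi> \<in> hom G H \<and> \<phi> x \<noteq> \<phi> y))"

subsection \<open>Tracial ultraproducts of matrix algebras\<close>

definition nontrivial_ultrafilter :: "nat filter \<Rightarrow> bool" where
  "nontrivial_ultrafilter \<alpha> \<longleftrightarrow>
     \<alpha> \<noteq> bot \<and>
     (\<forall>P. eventually P \<alpha> \<or> eventually (\<lambda>n. \<not> P n) \<alpha>) \<and>
     (\<exists>E :: nat \<Rightarrow> nat set. (\<forall>k. eventually (\<lambda>n. n \<in> E k) \<alpha>) \<and> (\<Inter>k. E k) = {})"

definition euclidean_norm :: "complex vec \<Rightarrow> real" where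
  "euclidean_norm v = sqrt (\<Sum>i<dim_vec v. (cmod (v $ i))\<^sup>2)"

definition operator_norm :: "complex mat \<Rightarrow> real" where
  "operator_norm A =
     (SUP v \<in> {v \<in> carrier_vec (dim_col A). euclidean_norm v \<le> 1}. euclidean_norm (A *\<^sub>v v))"

text \<open>The positive dimensions \<open>1, 2, \<dots>\<close> are indexed by \<open>0, 1, \<dots>\<close>: the \<open>n\<close>-th entry of a
  sequence is a matrix of size \<open>Suc n\<close>, because the normalized trace makes no sense in
  dimension zero.\<close>

definition bounded_matrix_sequences :: "(nat \<Rightarrow> complex mat) ring" where
  "bounded_matrix_sequences =
     \<lparr>carrier = {a. (\<forall>n. a n \<in> carrier_mat (Suc n) (Suc n)) \<and>
                    (\<exists>C. \<forall>n. operator_norm (a n) \<le> C)},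
      monoid.mult = (\<lambda>a b n. a n * b n), one = (\<lambda>n. 1\<^sub>m (Suc n)),
      zero = (\<lambda>n. 0\<^sub>m (Suc n) (Suc n)), add = (\<lambda>a b n. a n + b n)\<rparr>"

definition trace_null_ideal :: "nat filter \<Rightarrow> (nat \<Rightarrow> complex mat) set" where
  "trace_null_ideal \<alpha> =
     {a \<in> carrier bounded_matrix_sequences.
        ((\<lambda>n. normalized_trace (mat_adjoint (a n) * a n)) \<longlongrightarrow> 0) \<alpha>}"

definition tracial_ultraproduct :: "nat filter \<Rightarrow> (nat \<Rightarrow> complex mat) set ring" where
  "tracial_ultraproduct \<alpha> = bounded_matrix_sequences Quot trace_null_ideal \<alpha>"

text \<open>The involution of the quotient sends the coset of \<open>a\<close> to the coset of \<open>a\<^sup>*\<close>, which is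
  the image of the former under the entrywise adjoint, the ideal being self-adjoint.\<close>

definition ultraproduct_star :: "(nat \<Rightarrow> complex mat) set \<Rightarrow> (nat \<Rightarrow> complex mat) set" where
  "ultraproduct_star X = (\<lambda>a n. mat_adjoint (a n)) ` X"

text \<open>Along an ultrafilter the normalized traces of a bounded sequence converge, and the limit
  depends only on the coset.\<close>

definition ultraproduct_trace :: "nat filter \<Rightarrow> (nat \<Rightarrow> complex mat) set \<Rightarrow> complex" where
  "ultraproduct_trace \<alpha> X =
     (THE t. \<forall>a\<in>X. ((\<lambda>n. normalized_trace (a n)) \<longlongrightarrow> t) \<alpha>)"

subsection \<open>Embeddable characters\<close>

definition embeddable_character :: "('a, 'b) monoid_scheme \<Rightarrow> ('a \<Rightarrow> complex) \<Rightarrow> bool" where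
  "embeddable_character G \<tau> \<longleftrightarrow>
     group_character G \<tau> \<and>
     (\<exists>\<alpha>. nontrivial_ultrafilter \<alpha> \<and>
        (\<exists>f \<in> hom G (unitary_group (tracial_ultraproduct \<alpha>) ultraproduct_star).
           \<forall>g\<in>carrier G. \<tau> g = ultraproduct_trace \<alpha> (f g)))"

text \<open>Pointwise limits are limits of sequences: for a countable group the topology of pointwise
  convergence is metrizable.\<close>

definition approximation_property :: "('a, 'b) monoid_scheme \<Rightarrow> bool" where
  "approximation_property G \<longleftrightarrow>
     (\<forall>\<tau>. embeddable_character G \<tau> \<longrightarrow>
        (\<exists>\<sigma> :: nat \<Rightarrow> 'a \<Rightarrow> complex. (\<forall>k. trace_of_fd_rep G (\<sigma> k)) \<and>
           (\<forall>g\<in>carrier G. (\<lambda>k. \<sigma> k g) \<longlonglongrightarrow> \<tau> g)))"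

end

theory Submission
  imports Defs
    "HOL-Algebra.Weak_Morphisms"
    "HOL-Analysis.Function_Topology"
    "HOL-Analysis.Complex_Analysis_Basics"
    "HOL-Real_Asymp.Real_Asymp"
begin

text \<open>The set of pointwise limits of traces is closed and, via direct sums, midpoint-convex, so by
  the Krein--Milman theorem it contains every character of \<open>G\<close> once
  it contains each extremal character \<open>e\<close>. By rigidity we may assume that \<open>e\<close>
  vanishes off the center \<open>Z\<close>, on which it is multiplicative by extremality. Since \<open>Z\<close> has
  Folner sets \<open>A\<close>, the function \<open>z \<mapsto> e z * card {a \<in> A. z a \<in> A} / card A\<close> is close to \<open>e\<close> on
  \<open>Z\<close>, and it descends to a character of the image \<open>Q\<close> of \<open>Z\<close> in a finite quotient of \<open>G\<close> that is
  injective on a large finite set. Krein--Milman for the finite abelian group \<open>Q\<close> approximates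
  this character by combinations of homomorphisms from \<open>Q\<close> to the circle, and the extension of
  such a homomorphism by zero is the trace of an induced representation of \<open>G\<close>.\<close>

text \<open>A homomorphism from the center to the circle need not factor through any finite quotient
  of \<open>G\<close>, and residual finiteness only supplies quotient maps that are injective on a
  prescribed finite set. What can be transported along such a map is a function of finite support;
  this is the reason for multiplying \<open>e\<close> by the normalized overlap count of a Folner
  set, which preserves positive definiteness. The transported function is in general no longer
  multiplicative, but on a finite abelian group it is a convex combination of homomorphisms, and
  this is enough because the class of traces is only needed up to midpoints and limits. The
  extension by zero is supported in the whole preimage of \<open>Q\<close>, which has finite index
  but may exceed the center. Hence the quotient must also keep the noncentral elements under test
  out of \<open>Q\<close>; separating the two products of such an element with one that does not
  commute with it achieves this.\<close>

section \<open>Positive definite functions and elementary bounds for characters\<close>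

text \<open>The definition indexes by initial segments of the naturals, whereas the arguments below
  index by booleans and by pairs.\<close>

lemma positive_definite_sum:
  assumes "positive_definite G \<tau>" "finite I" "\<And>i. i \<in> I \<Longrightarrow> x i \<in> carrier G"
  shows "(\<Sum>i\<in>I. \<Sum>j\<in>I. cnj (c i) * c j * \<tau> (inv\<^bsub>G\<^esub> (x i) \<otimes>\<^bsub>G\<^esub> x j)) \<in> \<real>\<^sub>\<ge>\<^sub>0"
proof -
  obtain h where h: "bij_betw h {..<card I} I"
    using ex_bij_betw_nat_finite[OF assms(2)] by (auto simp: lessThan_atLeast0)
  have "\<forall>i<card I. x (h i) \<in> carrier G"
    using h assms(3) by (auto simp: bij_betw_def)
  then have "(\<Sum>i<card I. \<Sum>j<card I. cnj (c (h i)) * c (h j) *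
      \<tau> (inv\<^bsub>G\<^esub> (x (h i)) \<otimes>\<^bsub>G\<^esub> x (h j))) \<in> \<real>\<^sub>\<ge>\<^sub>0"
    using assms(1)[unfolded positive_definite_def, rule_format, of "card I" "x \<circ> h" "c \<circ> h"]
    by simp
  also have "(\<Sum>i<card I. \<Sum>j<card I. cnj (c (h i)) * c (h j) *
      \<tau> (inv\<^bsub>G\<^esub> (x (h i)) \<otimes>\<^bsub>G\<^esub> x (h j))) =
      (\<Sum>i<card I. \<Sum>j\<in>I. cnj (c (h i)) * c j * \<tau> (inv\<^bsub>G\<^esub> (x (h i)) \<otimes>\<^bsub>G\<^esub> x j))"
    by (intro sum.cong refl sum.reindex_bij_betw[OF h, where g = "\<lambda>j. cnj (c (h _)) * c j * \<tau> (inv\<^bsub>G\<^esub> (x (h _)) \<otimes>\<^bsub>G\<^esub> x j)"])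
  also have "\<dots> = (\<Sum>i\<in>I. \<Sum>j\<in>I. cnj (c i) * c j * \<tau> (inv\<^bsub>G\<^esub> (x i) \<otimes>\<^bsub>G\<^esub> x j))"
    by (rule sum.reindex_bij_betw[OF h])
  finally show ?thesis .
qed

lemma group_character_cong:
  assumes "group G" "\<And>g. g \<in> carrier G \<Longrightarrow> \<sigma> g = \<tau> g" "group_character G \<tau>"
  shows "group_character G \<sigma>"
proof -
  interpret group G by fact
  have "(\<Sum>i<n. \<Sum>j<n. cnj (c i) * c j * \<sigma> (inv\<^bsub>G\<^esub> (x i) \<otimes>\<^bsub>G\<^esub> x j)) \<in> \<real>\<^sub>\<ge>\<^sub>0"
    if "\<forall>i<n. x i \<in> carrier G" for n :: nat and x c
  proof -
    have "(\<Sum>i<n. \<Sum>j<n. cnj (c i) * c j * \<sigma> (inv\<^bsub>G\<^esub> (x i) \<otimes>\<^bsub>G\<^esub> x j)) =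
       (\<Sum>i<n. \<Sum>j<n. cnj (c i) * c j * \<tau> (inv\<^bsub>G\<^esub> (x i) \<otimes>\<^bsub>G\<^esub> x j))"
      using that assms(2) by (intro sum.cong refl) auto
    then show ?thesis
      using assms(3) that unfolding group_character_def positive_definite_def by simp
  qed
  then show ?thesis
    using assms(2,3) unfolding group_character_def positive_definite_def by simp
qed

context group
begin

text \<open>Positivity on the two points \<open>\<one>\<close> and \<open>g\<close>, that is, of a 2
  by 2 Gram matrix, already contains the Hermitian symmetry of a character and its bound by
  one.\<close>

lemma character_two_point:
  assumes "group_character G \<tau>" "g \<in> carrier G"
  shows "cnj a * a + cnj b * b + cnj a * b * \<tau> g + cnj b * a * \<tau> (inv g) \<in> \<real>\<^sub>\<ge>\<^sub>0"
proof -
  have "(\<Sum>i\<in>{False,True}. \<Sum>j\<in>{False,True}. cnj (if i then b else a) * (if j then b else a) *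
      \<tau> (inv (if i then g else \<one>) \<otimes> (if j then g else \<one>))) \<in> \<real>\<^sub>\<ge>\<^sub>0"
    by (rule positive_definite_sum) (use assms in \<open>auto simp: group_character_def\<close>)
  then show ?thesis
    using assms by (simp add: group_character_def algebra_simps)
qed

lemma character_inv:
  assumes "group_character G \<tau>" "g \<in> carrier G"
  shows "\<tau> (inv g) = cnj (\<tau> g)"
  \<comment> \<open>Both values are real: the coefficients 1, 1 make the imaginary parts of
    \<open>\<tau> g\<close> and \<open>\<tau> (inv g)\<close> opposite, and 1, \<open>\<i>\<close>
    make the real parts equal.\<close>
  using character_two_point[OF assms, of 1 1] character_two_point[OF assms, of 1 \<i>]
  by (auto simp: complex_nonneg_Reals_iff complex_eq_iff)

lemma character_norm_le_one:
  assumes "group_character G \<tau>" "g \<in> carrier G"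
  shows "cmod (\<tau> g) \<le> 1"
proof -
  have "cnj (\<tau> g) * \<tau> g = of_real ((cmod (\<tau> g))\<^sup>2)"
    by (metis complex_norm_square mult.commute of_real_power)
  then have "1 - (cmod (\<tau> g))\<^sup>2 \<ge> 0"
    using character_two_point[OF assms, of 1 "- cnj (\<tau> g)"] character_inv[OF assms]
    by (simp add: complex_nonneg_Reals_iff mult.commute)
  then show ?thesis
    using abs_square_le_1[of "cmod (\<tau> g)"] by simp
qed

end

section \<open>Compactness and the Krein-Milman theorem for characters\<close>

text \<open>Values off the carrier are arbitrary for a character; fixing them to be zero places the
  set inside a product of unit disks, compact by Tychonoff, where each defining condition involves
  finitely many coordinates and is closed.\<close>

lemma compact_characters:
  fixes G (structure)
  assumes "group G"
  shows "compact {\<tau>. group_character G \<tau> \<and> (\<forall>g. g \<notin> carrier G \<longrightarrow> \<tau> g = 0)}" (is "compact ?K")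
    and "closed {\<tau>. group_character G \<tau> \<and> (\<forall>g. g \<notin> carrier G \<longrightarrow> \<tau> g = 0)}"
proof -
  interpret group G by fact
  have cont: "continuous_on UNIV (\<lambda>\<tau>::'a \<Rightarrow> complex. \<tau> g)" for g
    by simp
  have "?K = (\<Inter>(n, x, c)\<in>{(n::nat, x, c::nat \<Rightarrow> complex). \<forall>i<n. x i \<in> carrier G}.
        (\<lambda>\<tau>. \<Sum>i<n. \<Sum>j<n. cnj (c i) * c j * \<tau> (inv (x i) \<otimes> x j)) -` \<real>\<^sub>\<ge>\<^sub>0) \<inter>
      (\<Inter>g\<in>carrier G. \<Inter>h\<in>carrier G. (\<lambda>\<tau>. \<tau> (h \<otimes> g \<otimes> inv h) - \<tau> g) -` {0}) \<inter>
      (\<lambda>\<tau>. \<tau> \<one>) -` {1} \<inter> (\<Inter>g\<in>-carrier G. (\<lambda>\<tau>. \<tau> g) -` {0})"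
    unfolding group_character_def positive_definite_def by auto
  also have "closed \<dots>"
    by (intro closed_Int closed_INT ballI) (auto intro!: closed_vimage continuous_intros cont)
  finally show closed: "closed ?K" .
  have "compactin (product_topology (\<lambda>i::'a. euclidean) UNIV) (Pi\<^sub>E UNIV (\<lambda>_. cball (0::complex) 1))"
    by (auto simp: compactin_PiE)
  then have "compact (Pi\<^sub>E (UNIV::'a set) (\<lambda>_. cball (0::complex) 1))"
    by (simp add: euclidean_product_topology)
  then have "compact (Pi\<^sub>E UNIV (\<lambda>_. cball 0 1) \<inter> ?K)"
    using closed by (rule compact_Int_closed)
  moreover have "?K \<subseteq> Pi\<^sub>E UNIV (\<lambda>_. cball 0 1)"
  proof safe
    fix \<tau> and g :: 'a
    assume "group_character G \<tau>" "\<forall>g. g \<notin> carrier G \<longrightarrow> \<tau> g = 0"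
    then show "\<tau> g \<in> cball 0 1"
      using character_norm_le_one by (cases "g \<in> carrier G") auto
  qed simp
  ultimately show "compact ?K"
    by (simp only: inf_absorb2)
qed

text \<open>Lexicographic maximisation along a sequence of functionals replaces Zorn's lemma in the
  proof of the Krein--Milman theorem.\<close>

lemma lexicographic_maximum:
  fixes L :: "nat \<Rightarrow> 'a::topological_space \<Rightarrow> real"
  assumes "compact K" "closed K" "K \<noteq> {}" "\<And>n. continuous_on UNIV (L n)"
  obtains e where "e \<in> K" "\<And>n \<rho>. \<rho> \<in> K \<Longrightarrow> (\<And>m. m < n \<Longrightarrow> L m \<rho> = L m e) \<Longrightarrow> L n \<rho> \<le> L n e"
proof -
  \<comment> \<open>\<open>M n\<close> retains the points of \<open>K\<close> at which
    \<open>L 0\<close>, ..., \<open>L (n - 1)\<close> are lexicographically maximal; these sets are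
    nested, closed and nonempty, and any common point serves as \<open>e\<close>.\<close>
  define M where "M = rec_nat K (\<lambda>n S. {\<sigma>\<in>S. \<forall>\<rho>\<in>S. L n \<rho> \<le> L n \<sigma>})"
  have M0: "M 0 = K" and MSuc: "M (Suc n) = {\<sigma>\<in>M n. \<forall>\<rho>\<in>M n. L n \<rho> \<le> L n \<sigma>}" for n
    by (auto simp: M_def)
  have antimono: "M n \<subseteq> M m" if "m \<le> n" for m n
    by (rule lift_Suc_antimono_le[OF _ that]) (auto simp: MSuc)
  have inv: "closed (M n) \<and> M n \<noteq> {} \<and> M n \<subseteq> K" for n
  proof (induction n)
    case (Suc n)
    have "M (Suc n) = M n \<inter> (\<Inter>\<rho>\<in>M n. {\<sigma>. L n \<rho> \<le> L n \<sigma>})"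
      by (auto simp: MSuc)
    moreover have "closed \<dots>"
      using Suc assms(4) by (intro closed_Int closed_INT ballI closed_Collect_le) auto
    moreover have "compact (M n)"
      using Suc assms(1) by (metis compact_Int_closed inf.absorb_iff2)
    then have "\<exists>x\<in>M n. \<forall>y\<in>M n. L n y \<le> L n x"
      using Suc assms(4) by (intro continuous_attains_sup) (auto intro: continuous_on_subset)
    ultimately show ?case
      using Suc by (auto simp: MSuc)
  qed (use assms M0 in auto)
  have "K \<inter> \<Inter>(range M) \<noteq> {}"
  proof (rule compact_imp_fip_image[OF assms(1)])
    fix I :: "nat set" assume "finite I"
    then obtain n where "\<forall>i\<in>I. i \<le> n"
      using finite_nat_set_iff_bounded_le by blast
    then have "M n \<subseteq> M i" if "i \<in> I" for i
      using antimono that by simp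
    then have "M n \<subseteq> K \<inter> \<Inter>(M ` I)"
      using inv[of n] by auto
    then show "K \<inter> \<Inter>(M ` I) \<noteq> {}"
      using inv[of n] by (metis bot.extremum_uniqueI)
  qed (use inv in auto)
  then obtain e where e: "e \<in> K" "\<And>n. e \<in> M n"
    by blast
  have "\<rho> \<in> M n" if "\<rho> \<in> K" "\<And>m. m < n \<Longrightarrow> L m \<rho> = L m e" for \<rho> n
    using that
  proof (induction n)
    case (Suc n)
    then have "L n \<rho> = L n e"
      by simp
    then show ?case
      using e(2)[of "Suc n"] Suc by (auto simp: MSuc)
  qed (simp add: M0)
  then show ?thesis
    using that[OF e(1)] e(2)[of "Suc _"] unfolding MSuc by blast
qed

text \<open>If a lexicographic maximum is a proper convex combination, then one functional after
  another it agrees with both end points. The first functional is the linear form of interest and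
  the others list all values on the countable carrier, so one choice of \<open>e\<close> gives
  maximality for the form and extremality together.\<close>

lemma extremal_character_maximizing:
  assumes "group G" "countable (carrier G)" "group_character G \<tau>" "F \<subseteq> carrier G"
  obtains e where "extremal_character G e"
    "Re (\<Sum>g\<in>F. w g * \<tau> g) \<le> Re (\<Sum>g\<in>F. w g * e g)"
proof -
  interpret group G by fact
  define K where "K = {\<tau>. group_character G \<tau> \<and> (\<forall>g. g \<notin> carrier G \<longrightarrow> \<tau> g = 0)}"
  define E where "E = from_nat_into (carrier G)"
  have E: "E n \<in> carrier G" for n
    unfolding E_def by (rule from_nat_into) auto
  have range_E: "range E = carrier G"
    unfolding E_def using assms(2) by (intro range_from_nat_into) auto
  \<comment> \<open>Index 0 is the form; the odd indices read off real parts and the later even ones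
    imaginary parts of the values at the points \<open>E n\<close>.\<close>
  define L where "L = (\<lambda>n (\<sigma>::'a \<Rightarrow> complex). case n of 0 \<Rightarrow> Re (\<Sum>g\<in>F. w g * \<sigma> g)
     | Suc m \<Rightarrow> (if even m then Re (\<sigma> (E (m div 2))) else Im (\<sigma> (E (m div 2)))))"
  \<comment> \<open>The competitors in the definition of extremality are arbitrary off the carrier;
    \<open>res\<close> moves them into \<open>K\<close> without changing any
    \<open>L n\<close>.\<close>
  define res where "res = (\<lambda>\<sigma> g. if g \<in> carrier G then \<sigma> g else (0::complex))"
  have res: "res \<sigma> \<in> K" if "group_character G \<sigma>" for \<sigma>
    using group_character_cong[OF assms(1) _ that, of "res \<sigma>"] by (simp add: K_def res_def)
  have L_res: "L n (res \<sigma>) = L n \<sigma>" for n \<sigma>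
    using E assms(4) by (auto simp: L_def res_def subset_iff split: nat.split intro!: sum.cong)
  have cont: "continuous_on UNIV (L n)" for n
    unfolding L_def by (cases n; cases "even (n - 1)") (auto intro!: continuous_intros)
  obtain e where e: "e \<in> K"
    and max: "\<And>n \<rho>. \<rho> \<in> K \<Longrightarrow> (\<And>m. m < n \<Longrightarrow> L m \<rho> = L m e) \<Longrightarrow> L n \<rho> \<le> L n e"
    using lexicographic_maximum[of K L] compact_characters[OF assms(1)] res[OF assms(3)] cont
    unfolding K_def by blast
  have "extremal_character G e"
    unfolding extremal_character_def
  proof (intro conjI allI impI; (elim conjE)?)
    show "group_character G e"
      using e by (simp add: K_def)
  next
    fix \<sigma>1 \<sigma>2 and t :: real
    assume \<sigma>: "group_character G \<sigma>1" "group_character G \<sigma>2" and t: "0 < t" "t < 1"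
      and eq: "\<forall>g\<in>carrier G. e g = of_real t * \<sigma>1 g + of_real (1 - t) * \<sigma>2 g"
    have affine: "L n e = t * L n \<sigma>1 + (1 - t) * L n \<sigma>2" for n
    proof (cases n)
      case 0
      have "(\<Sum>g\<in>F. w g * e g) =
          of_real t * (\<Sum>g\<in>F. w g * \<sigma>1 g) + of_real (1 - t) * (\<Sum>g\<in>F. w g * \<sigma>2 g)"
        unfolding sum_distrib_left sum.distrib[symmetric]
      proof (rule sum.cong[OF refl])
        fix g assume "g \<in> F"
        then have "e g = of_real t * \<sigma>1 g + of_real (1 - t) * \<sigma>2 g"
          using eq assms(4) by blast
        then show "w g * e g = of_real t * (w g * \<sigma>1 g) + of_real (1 - t) * (w g * \<sigma>2 g)"
          by (simp only:) (simp add: algebra_simps)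
      qed
      then show ?thesis
        by (simp only: L_def 0 nat.case) simp
    qed (use eq E in \<open>auto simp: L_def\<close>)
    have L_eq: "L n \<sigma>1 = L n e \<and> L n \<sigma>2 = L n e" for n
    proof (induction n rule: less_induct)
      case (less n)
      then have "L n \<sigma>1 \<le> L n e" "L n \<sigma>2 \<le> L n e"
        using max[of "res \<sigma>1" n] max[of "res \<sigma>2" n] res[OF \<sigma>(1)] res[OF \<sigma>(2)]
        by (auto simp: L_res)
      moreover have "t * (L n e - L n \<sigma>1) + (1 - t) * (L n e - L n \<sigma>2) = 0"
        using affine[of n] by (simp add: algebra_simps)
      ultimately have "t * (L n e - L n \<sigma>1) = 0" "(1 - t) * (L n e - L n \<sigma>2) = 0"
        using t by (smt (verit, best) mult_nonneg_nonneg)+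
      then show ?case
        using t by auto
    qed
    show "\<forall>g\<in>carrier G. \<sigma>1 g = e g \<and> \<sigma>2 g = e g"
    proof
      fix g assume "g \<in> carrier G"
      then obtain n where "g = E n"
        using range_E by blast
      then show "\<sigma>1 g = e g \<and> \<sigma>2 g = e g"
        using L_eq[of "Suc (2 * n)"] L_eq[of "Suc (2 * n + 1)"]
        by (simp add: L_def complex_eq_iff)
    qed
  qed
  moreover have "Re (\<Sum>g\<in>F. w g * \<tau> g) \<le> Re (\<Sum>g\<in>F. w g * e g)"
    using max[OF res[OF assms(3)], of 0] unfolding L_res by (simp add: L_def)
  ultimately show ?thesis
    using that by blast
qed

text \<open>This is Hahn-Banach separation in finite dimension, carried out by hand. At a point of
  \<open>T\<close> nearly closest to \<open>\<tau>\<close> on \<open>F\<close>, the gradient of the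
  squared distance separates \<open>\<tau>\<close> from \<open>T\<close>; yet some extremal
  character, itself approximable by \<open>T\<close>, does at least as well as \<open>\<tau>\<close>
  on that functional. As only midpoints are known to stay in \<open>T\<close>, the nearest point is
  replaced by a near-minimizer and the derivative by a difference quotient at a dyadic step. The
  class \<open>T\<close> is abstract because it is instantiated both for \<open>G\<close> and for
  the image of its center in a finite quotient.\<close>

lemma character_approximation:
  fixes G (structure)
  assumes "group G" "countable (carrier G)"
    and midpoint: "\<And>\<sigma>1 \<sigma>2. T \<sigma>1 \<Longrightarrow> T \<sigma>2 \<Longrightarrow> T (\<lambda>g. (\<sigma>1 g + \<sigma>2 g) / 2)"
    and bounded: "\<And>\<sigma> g. T \<sigma> \<Longrightarrow> g \<in> carrier G \<Longrightarrow> cmod (\<sigma> g) \<le> 1"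
    and extremal: "\<And>e F \<epsilon>. extremal_character G e \<Longrightarrow> finite F \<Longrightarrow> F \<subseteq> carrier G \<Longrightarrow> \<epsilon> > 0 \<Longrightarrow>
      \<exists>\<sigma>. T \<sigma> \<and> (\<forall>g\<in>F. cmod (\<sigma> g - e g) < \<epsilon>)"
    and \<tau>: "group_character G \<tau>" and F: "finite F" "F \<subseteq> carrier G" and "\<epsilon> > 0"
  shows "\<exists>\<sigma>. T \<sigma> \<and> (\<forall>g\<in>F. cmod (\<sigma> g - \<tau> g) < \<epsilon>)"
proof (rule ccontr)
  assume contra: "\<not> ?thesis"
  interpret group G by fact
  define D where "D = (\<lambda>\<sigma>. \<Sum>g\<in>F. (cmod (\<sigma> g - \<tau> g))\<^sup>2)"
  define d where "d = Inf (D ` {\<sigma>. T \<sigma>})"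
  obtain \<sigma>\<^sub>1 where \<sigma>\<^sub>1: "T \<sigma>\<^sub>1"
  proof -
    obtain e where "extremal_character G e"
      by (rule extremal_character_maximizing[OF assms(1,2) \<tau> F(2)])
    from extremal[OF this F, of 1] show ?thesis
      using that by auto
  qed
  have D_ge: "\<epsilon>\<^sup>2 \<le> D \<sigma>" if "T \<sigma>" for \<sigma>
  proof -
    obtain g where g: "g \<in> F" "\<epsilon> \<le> cmod (\<sigma> g - \<tau> g)"
      using contra \<open>T \<sigma>\<close> by (auto simp: not_less)
    then have "\<epsilon>\<^sup>2 \<le> (cmod (\<sigma> g - \<tau> g))\<^sup>2"
      using \<open>\<epsilon> > 0\<close> by (intro power_mono) auto
    also have "\<dots> \<le> D \<sigma>"
      unfolding D_def using g(1) F(1) by (intro member_le_sum) auto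
    finally show ?thesis .
  qed
  have "\<epsilon>\<^sup>2 \<le> d"
    unfolding d_def using \<sigma>\<^sub>1 D_ge by (intro cInf_greatest) auto
  then have "d > 0"
    using \<open>\<epsilon> > 0\<close> by (smt (verit) zero_less_power)
  have d_le: "d \<le> D \<sigma>" if "T \<sigma>" for \<sigma>
    unfolding d_def using that D_ge by (intro cInf_lower) (auto intro!: bdd_belowI2)
  \<comment> \<open>All values lie in the unit disk, so two members of \<open>T\<close> have squared
    distance at most \<open>B\<close> on \<open>F\<close>. The choice of \<open>k\<close> makes the
    quadratic term \<open>s\<^sup>2 * B\<close> of the expansion at step
    \<open>s = (1/2) ^ k\<close> less than \<open>s * (d / 2)\<close>.\<close>
  define B where "B = 4 * real (card F)"
  obtain k where k: "B * (1/2) ^ k < d / 2"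
  proof -
    have "(\<lambda>k. B * (1/2) ^ k) \<longlonglongrightarrow> B * 0"
      by (intro tendsto_intros LIMSEQ_power_zero) auto
    then have "eventually (\<lambda>k. B * (1/2) ^ k < d / 2) sequentially"
      using \<open>d > 0\<close> by (intro order_tendstoD) auto
    then show ?thesis
      using that by (auto simp: eventually_sequentially)
  qed
  define s :: real where "s = (1/2) ^ k"
  have s: "s > 0" "s * B < d / 2"
    using k by (auto simp: s_def mult.commute)
  \<comment> \<open>The distance from the infimum is held below the same \<open>s * (d / 2)\<close>,
    so that after division by \<open>2 * s\<close> the two errors together leave the bound
    \<open>d / 2\<close>.\<close>
  obtain \<sigma>\<^sub>0 where \<sigma>\<^sub>0: "T \<sigma>\<^sub>0" "D \<sigma>\<^sub>0 < d + s * (d / 2)"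
    using cInf_lessD[of "D ` {\<sigma>. T \<sigma>}" "d + s * (d / 2)"] \<sigma>\<^sub>1 s \<open>d > 0\<close>
    unfolding d_def[symmetric] by auto
  have segment: "T (\<lambda>g. \<sigma>\<^sub>0 g + (1/2) ^ n * (\<sigma> g - \<sigma>\<^sub>0 g))" if "T \<sigma>" for \<sigma> n
  proof (induction n)
    case (Suc n)
    have "(\<lambda>g. \<sigma>\<^sub>0 g + (1/2) ^ Suc n * (\<sigma> g - \<sigma>\<^sub>0 g)) =
        (\<lambda>g. (\<sigma>\<^sub>0 g + (\<sigma>\<^sub>0 g + (1/2) ^ n * (\<sigma> g - \<sigma>\<^sub>0 g))) / 2)"
      by (simp add: field_simps)
    then show ?case
      using midpoint[OF \<sigma>\<^sub>0(1) Suc] by simp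
  qed (use that in simp)
  \<comment> \<open>Up to a factor this is the conjugate of the gradient of \<open>D\<close> at
    \<open>\<sigma>\<^sub>0\<close>. At \<open>\<tau>\<close> the form takes the value
    \<open>D \<sigma>\<^sub>0 \<ge> d\<close>, at least twice the bound that holds on
    \<open>T\<close>.\<close>
  define w where "w = (\<lambda>g. cnj (\<tau> g - \<sigma>\<^sub>0 g))"
  have separation: "Re (\<Sum>g\<in>F. w g * (\<sigma> g - \<sigma>\<^sub>0 g)) \<le> d / 2" if "T \<sigma>" for \<sigma>
  proof -
    have "cmod (\<sigma> g - \<sigma>\<^sub>0 g) \<le> 2" if "g \<in> F" for g
      using bounded[OF \<open>T \<sigma>\<close>, of g] bounded[OF \<sigma>\<^sub>0(1), of g] F(2) that
        norm_triangle_ineq4[of "\<sigma> g" "\<sigma>\<^sub>0 g"] by auto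
    then have "(\<Sum>g\<in>F. (cmod (\<sigma> g - \<sigma>\<^sub>0 g))\<^sup>2) \<le> (\<Sum>g\<in>F. 2\<^sup>2)"
      by (intro sum_mono power_mono) auto
    then have N: "(\<Sum>g\<in>F. (cmod (\<sigma> g - \<sigma>\<^sub>0 g))\<^sup>2) \<le> B"
      by (simp add: B_def)
    have expand: "(cmod (\<sigma>\<^sub>0 g + of_real s * (\<sigma> g - \<sigma>\<^sub>0 g) - \<tau> g))\<^sup>2 =
        (cmod (\<sigma>\<^sub>0 g - \<tau> g))\<^sup>2 - 2 * s * Re (w g * (\<sigma> g - \<sigma>\<^sub>0 g)) +
        s\<^sup>2 * (cmod (\<sigma> g - \<sigma>\<^sub>0 g))\<^sup>2" for g
      unfolding w_def cmod_power2 by (simp add: algebra_simps power2_eq_square)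
    have "d \<le> D (\<lambda>g. \<sigma>\<^sub>0 g + of_real s * (\<sigma> g - \<sigma>\<^sub>0 g))"
      using d_le[OF segment[OF that, of k]] by (simp add: s_def)
    also have "\<dots> = D \<sigma>\<^sub>0 - 2 * s * Re (\<Sum>g\<in>F. w g * (\<sigma> g - \<sigma>\<^sub>0 g)) +
        s\<^sup>2 * (\<Sum>g\<in>F. (cmod (\<sigma> g - \<sigma>\<^sub>0 g))\<^sup>2)"
      unfolding D_def expand Re_sum sum.distrib sum_subtractf sum_distrib_left ..
    also have "\<dots> \<le> d + s * (d / 2) - 2 * s * Re (\<Sum>g\<in>F. w g * (\<sigma> g - \<sigma>\<^sub>0 g)) + s\<^sup>2 * B"
      using \<sigma>\<^sub>0(2) N s(1) by (intro add_mono diff_mono mult_left_mono) auto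
    also have "s\<^sup>2 * B = s * (s * B)"
      by (simp add: power2_eq_square)
    also have "s * (s * B) \<le> s * (d / 2)"
      using s by (intro mult_left_mono) auto
    finally have "s * (2 * Re (\<Sum>g\<in>F. w g * (\<sigma> g - \<sigma>\<^sub>0 g))) \<le> s * d"
      by (simp add: algebra_simps)
    then show ?thesis
      using s(1) by simp
  qed
  obtain e where e: "extremal_character G e" "Re (\<Sum>g\<in>F. w g * \<tau> g) \<le> Re (\<Sum>g\<in>F. w g * e g)"
    by (rule extremal_character_maximizing[OF assms(1,2) \<tau> F(2)])
  \<comment> \<open>The weights have modulus at most 2, so an error \<open>\<eta>\<close> at each
    point costs at most \<open>2 * \<eta> * card F < d / 2\<close>; the summand 4 keeps the
    denominator positive for empty \<open>F\<close>.\<close>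
  define \<eta> where "\<eta> = d / (4 * real (card F) + 4)"
  have "\<eta> > 0"
    using \<open>d > 0\<close> by (simp add: \<eta>_def add_nonneg_pos)
  then obtain \<sigma> where \<sigma>: "T \<sigma>" "\<And>g. g \<in> F \<Longrightarrow> cmod (\<sigma> g - e g) < \<eta>"
    using extremal[OF e(1) F] by blast
  have "cmod (\<Sum>g\<in>F. w g * (e g - \<sigma> g)) \<le> (\<Sum>g\<in>F. 2 * \<eta>)"
  proof (rule sum_norm_le)
    fix g assume "g \<in> F"
    then have "cmod (w g) \<le> 2"
      using bounded[OF \<sigma>\<^sub>0(1), of g] character_norm_le_one[OF \<tau>, of g] F(2)
        norm_triangle_ineq4[of "\<tau> g" "\<sigma>\<^sub>0 g"] by (auto simp: w_def simp del: complex_cnj_diff)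
    then show "cmod (w g * (e g - \<sigma> g)) \<le> 2 * \<eta>"
      using \<sigma>(2)[OF \<open>g \<in> F\<close>] by (simp add: norm_mult norm_minus_commute mult_mono)
  qed
  also have "\<dots> < d / 2"
    using \<open>d > 0\<close> by (simp add: \<eta>_def field_simps)
  finally have "Re (\<Sum>g\<in>F. w g * (e g - \<sigma> g)) < d / 2"
    using complex_Re_le_cmod le_less_trans by blast
  moreover have "Re (\<Sum>g\<in>F. w g * (\<tau> g - \<sigma>\<^sub>0 g)) = D \<sigma>\<^sub>0"
    unfolding D_def Re_sum w_def cmod_power2
    by (intro sum.cong refl) (simp add: power2_eq_square algebra_simps)
  \<comment> \<open>The form at \<open>e - \<sigma>\<^sub>0\<close> splits at
    \<open>\<sigma>\<close> into two parts, one at most \<open>d / 2\<close> and the other strictly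
    less, against a value of at least \<open>D \<sigma>\<^sub>0 \<ge> d\<close>.\<close>
  ultimately show False
    using separation[OF \<sigma>(1)] e(2) d_le[OF \<sigma>\<^sub>0(1)]
    by (simp add: right_diff_distrib sum_subtractf)
qed

section \<open>Extremal characters on the center\<close>

context group
begin

lemma group_center_commute:
  "z \<in> group_center G \<Longrightarrow> g \<in> carrier G \<Longrightarrow> z \<otimes> g = g \<otimes> z"
  by (auto simp: group_center_def)

lemma inv_in_group_center:
  assumes "z \<in> group_center G"
  shows "inv z \<in> group_center G"
proof -
  have "inv z \<otimes> g = g \<otimes> inv z" if "g \<in> carrier G" for g
    using assms that group_center_commute[OF assms that]
    by (metis (no_types, lifting) group_center_def inv_closed inv_solve_left inv_solve_right m_assoc m_closed mem_Collect_eq)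
  then show ?thesis
    using assms by (auto simp: group_center_def)
qed

text \<open>In the GNS representation of \<open>\<tau>\<close> with cyclic vector \<open>v\<close>,
  this is the normalized vector state of \<open>v + c z v\<close>, and \<open>N\<close> is the
  squared norm of that vector. Centrality of \<open>z\<close> makes the state invariant under
  conjugation again.\<close>

lemma character_center_perturbation:
  fixes c :: complex
  assumes \<tau>: "group_character G \<tau>" and z: "z \<in> group_center G"
    and N: "N = 1 + (cmod c)\<^sup>2 + 2 * Re (c * \<tau> z)" "N > 0"
  shows "group_character G
    (\<lambda>g. ((1 + of_real ((cmod c)\<^sup>2)) * \<tau> g + c * \<tau> (z \<otimes> g) + cnj c * \<tau> (inv z \<otimes> g)) / of_real N)"
    (is "group_character G (\<lambda>g. ?S g / of_real N)")
proof -
  have z_carrier [simp]: "z \<in> carrier G"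
    using z by (simp add: group_center_def)
  have class_fun: "\<tau> (h \<otimes> g \<otimes> inv h) = \<tau> g" if "g \<in> carrier G" "h \<in> carrier G" for g h
    using \<tau> that by (simp add: group_character_def)
  have conj_center: "y \<otimes> (h \<otimes> g \<otimes> inv h) = h \<otimes> (y \<otimes> g) \<otimes> inv h"
    if "y \<in> group_center G" "g \<in> carrier G" "h \<in> carrier G" for y g h
  proof -
    have "y \<in> carrier G"
      using that by (simp add: group_center_def)
    then have "y \<otimes> (h \<otimes> g \<otimes> inv h) = (y \<otimes> h) \<otimes> g \<otimes> inv h"
      using that by (simp add: m_assoc)
    then show ?thesis
      using that \<open>y \<in> carrier G\<close> by (simp add: group_center_commute m_assoc)
  qed
  have pd: "(\<Sum>i<n. \<Sum>j<n. cnj (a i) * a j * (?S (inv (x i) \<otimes> x j) / of_real N)) \<in> \<real>\<^sub>\<ge>\<^sub>0"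
    if x: "\<forall>i<n. x i \<in> carrier G" for n :: nat and x a
  proof -
    \<comment> \<open>Positivity of \<open>\<tau>\<close> is applied to the element of the group
      algebra obtained from the sum of the \<open>a i * x i\<close> by multiplication with
      \<open>1 + c z\<close>: each point splits in two, and the boolean marks the translate by
      \<open>z\<close>.\<close>
    define y where "y = (\<lambda>(i, b). if b then x i \<otimes> z else x i)"
    define u where "u = (\<lambda>(i, b). if b then a i * c else a i)"
    define I where "I = {..<n} \<times> {False, True}"
    have "(\<Sum>p\<in>I. \<Sum>q\<in>I. cnj (u p) * u q * \<tau> (inv (y p) \<otimes> y q)) \<in> \<real>\<^sub>\<ge>\<^sub>0"
      by (rule positive_definite_sum) (use \<tau> x in \<open>auto simp: group_character_def y_def I_def\<close>)
    also have "(\<Sum>p\<in>I. \<Sum>q\<in>I. cnj (u p) * u q * \<tau> (inv (y p) \<otimes> y q)) =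
       (\<Sum>i<n. \<Sum>j<n. cnj (a i) * a j * ?S (inv (x i) \<otimes> x j))"
    proof -
      have sum_I: "sum f I = (\<Sum>i<n. \<Sum>b\<in>{False,True}. f (i, b))" for f :: "_ \<Rightarrow> complex"
        unfolding I_def sum.cartesian_product by (simp add: split_def)
      have 1: "inv (x i \<otimes> z) \<otimes> (x j \<otimes> z) = inv (x i) \<otimes> x j" if "i < n" "j < n" for i j
      proof -
        have "inv (x i \<otimes> z) \<otimes> (x j \<otimes> z) = inv (z \<otimes> x i) \<otimes> (z \<otimes> x j)"
          using group_center_commute[OF z] x that by simp
        also have "\<dots> = inv (x i) \<otimes> x j"
          using x that by (simp add: inv_mult_group m_assoc) (simp flip: m_assoc)
        finally show ?thesis .
      qed
      have 2: "inv (x i) \<otimes> (x j \<otimes> z) = z \<otimes> (inv (x i) \<otimes> x j)" if "i < n" "j < n" for i j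
        using group_center_commute[OF z, of "inv (x i) \<otimes> x j"] x that by (simp add: m_assoc)
      have 3: "inv (x i \<otimes> z) \<otimes> x j = inv z \<otimes> (inv (x i) \<otimes> x j)" if "i < n" "j < n" for i j
        using x that by (simp add: inv_mult_group m_assoc)
      have "(\<Sum>p\<in>I. \<Sum>q\<in>I. cnj (u p) * u q * \<tau> (inv (y p) \<otimes> y q)) =
          (\<Sum>i<n. \<Sum>b\<in>{False,True}. \<Sum>j<n. \<Sum>b'\<in>{False,True}.
            cnj (u (i,b)) * u (j,b') * \<tau> (inv (y (i,b)) \<otimes> y (j,b')))"
        unfolding sum_I ..
      also have "\<dots> = (\<Sum>i<n. \<Sum>j<n. \<Sum>b\<in>{False,True}. \<Sum>b'\<in>{False,True}.
            cnj (u (i,b)) * u (j,b') * \<tau> (inv (y (i,b)) \<otimes> y (j,b')))"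
        by (intro sum.cong refl sum.swap)
      also have "\<dots> = (\<Sum>i<n. \<Sum>j<n. cnj (a i) * a j * ?S (inv (x i) \<otimes> x j))"
        by (intro sum.cong refl)
          (simp add: u_def y_def 1 2 3 algebra_simps complex_norm_square del: of_real_power)
      finally show ?thesis .
    qed
    finally have pos: "(\<Sum>i<n. \<Sum>j<n. cnj (a i) * a j * ?S (inv (x i) \<otimes> x j)) \<in> \<real>\<^sub>\<ge>\<^sub>0" .
    have "(\<Sum>i<n. \<Sum>j<n. cnj (a i) * a j * (?S (inv (x i) \<otimes> x j) / of_real N)) =
        (\<Sum>i<n. \<Sum>j<n. cnj (a i) * a j * ?S (inv (x i) \<otimes> x j)) / of_real N"
      by (simp only: sum_divide_distrib times_divide_eq_right)
    then show ?thesis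
      using pos N(2) by (auto simp: complex_nonneg_Reals_iff)
  qed
  have "\<tau> \<one> = 1" "\<tau> (inv z) = cnj (\<tau> z)"
    using \<tau> character_inv[OF \<tau>] by (auto simp: group_character_def)
  then have "?S \<one> = of_real N"
    by (simp add: N(1) complex_eq_iff)
  then have one: "?S \<one> / of_real N = 1"
    using N(2) by simp
  show ?thesis
    unfolding group_character_def positive_definite_def
    using pd one conj_center[OF z] conj_center[OF inv_in_group_center[OF z]] class_fun by auto
qed

text \<open>The perturbations by \<open>c\<close> and \<open>-c\<close> average to \<open>\<tau>\<close>; comparing \<open>c = 1/2\<close> and \<open>c = \<i>/2\<close>
  separates \<open>\<tau> (z g)\<close> from \<open>\<tau> (z\<^sup>-\<^sup>1 g)\<close>.\<close>

lemma extremal_character_center_mult: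
  assumes \<tau>: "extremal_character G \<tau>" and z: "z \<in> group_center G" and g: "g \<in> carrier G"
  shows "\<tau> (z \<otimes> g) = \<tau> z * \<tau> g"
proof -
  have char: "group_character G \<tau>"
    using \<tau> by (simp add: extremal_character_def)
  have z_carrier: "z \<in> carrier G"
    using z by (simp add: group_center_def)
  have key: "c * \<tau> (z \<otimes> g) + cnj c * \<tau> (inv z \<otimes> g) = of_real (2 * Re (c * \<tau> z)) * \<tau> g"
    if c: "cmod c = 1/2" for c
  proof -
    define N where "N = (\<lambda>c. 1 + (cmod c)\<^sup>2 + 2 * Re (c * \<tau> z))"
    define \<sigma> where "\<sigma> = (\<lambda>c g. ((1 + of_real ((cmod c)\<^sup>2)) * \<tau> g + c * \<tau> (z \<otimes> g) +
        cnj c * \<tau> (inv z \<otimes> g)) / of_real (N c))"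
    \<comment> \<open>With modulus 1/2 the last term of \<open>N\<close> is at least -1, so
      \<open>N\<close> is at least 1/4.\<close>
    have N_pos: "N c' > 0" if "cmod c' = 1/2" for c'
    proof -
      have "\<bar>Re (c' * \<tau> z)\<bar> \<le> cmod (c' * \<tau> z)"
        by (rule abs_Re_le_cmod)
      also have "\<dots> \<le> 1/2"
        unfolding norm_mult that using character_norm_le_one[OF char z_carrier] by simp
      finally show ?thesis
        unfolding N_def that power2_eq_square by linarith
    qed
    have pos: "N c > 0" "N (-c) > 0"
      using N_pos c by auto
    have NN: "N c + N (-c) = 2 * (1 + (cmod c)\<^sup>2)"
      by (simp add: N_def)
    \<comment> \<open>Weights proportional to the two normalizations cancel them, after which the
      terms that change sign with \<open>c\<close> cancel as well.\<close>
    define t where "t = N c / (N c + N (-c))"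
    have t: "0 < t" "t < 1" "1 - t = N (-c) / (N c + N (-c))"
      using pos by (auto simp: t_def field_simps)
    have "\<tau> h = of_real t * \<sigma> c h + of_real (1 - t) * \<sigma> (-c) h" for h
    proof -
      have 1: "of_real t * \<sigma> c h = ((1 + of_real ((cmod c)\<^sup>2)) * \<tau> h + c * \<tau> (z \<otimes> h) +
        cnj c * \<tau> (inv z \<otimes> h)) / of_real (N c + N (-c))"
        using pos by (simp add: t_def \<sigma>_def del: of_real_add)
      have 2: "of_real (1 - t) * \<sigma> (-c) h = ((1 + of_real ((cmod c)\<^sup>2)) * \<tau> h - c * \<tau> (z \<otimes> h) -
        cnj c * \<tau> (inv z \<otimes> h)) / of_real (N c + N (-c))"
        unfolding t(3) using pos by (simp add: \<sigma>_def del: of_real_add)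
      have "of_real t * \<sigma> c h + of_real (1 - t) * \<sigma> (-c) h =
          of_real (2 * (1 + (cmod c)\<^sup>2)) * \<tau> h / of_real (N c + N (-c))"
        unfolding 1 2 add_divide_distrib[symmetric] by (simp add: algebra_simps)
      also have "\<dots> = \<tau> h"
        using pos unfolding NN[symmetric] by (simp del: of_real_add)
      finally show ?thesis ..
    qed
    moreover have "group_character G (\<sigma> c)" "group_character G (\<sigma> (-c))"
      using character_center_perturbation[OF char z _ pos(1), of c]
        character_center_perturbation[OF char z _ pos(2), of "-c"]
      unfolding \<sigma>_def by (auto simp: N_def)
    ultimately have "\<sigma> c g = \<tau> g"
      using \<tau>[unfolded extremal_character_def] t(1,2) g by blast
    then have "(1 + of_real ((cmod c)\<^sup>2)) * \<tau> g + c * \<tau> (z \<otimes> g) + cnj c * \<tau> (inv z \<otimes> g) =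
        of_real (N c) * \<tau> g"
      using pos(1) by (simp add: \<sigma>_def field_simps)
    then show ?thesis
      by (simp add: N_def algebra_simps)
  qed
  show ?thesis
    using key[of "1/2"] key[of "\<i>/2"] by (auto simp: complex_eq_iff norm_divide algebra_simps)
qed

lemma extremal_character_center_norm:
  assumes \<tau>: "extremal_character G \<tau>" and z: "z \<in> group_center G"
  shows "cmod (\<tau> z) = 1"
proof -
  have char: "group_character G \<tau>" and zc: "z \<in> carrier G"
    using assms by (auto simp: extremal_character_def group_center_def)
  have "\<tau> z * cnj (\<tau> z) = 1"
    using extremal_character_center_mult[OF \<tau> z, of "inv z"] character_inv[OF char zc] char zc
    by (simp add: group_character_def)
  then have "complex_of_real ((cmod (\<tau> z))\<^sup>2) = of_real 1"
    by (simp add: complex_norm_square del: of_real_power)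
  then have "(cmod (\<tau> z))\<^sup>2 = 1"
    unfolding of_real_eq_iff .
  then show ?thesis
    using norm_ge_zero[of "\<tau> z"] by (auto simp: power2_eq_1_iff)
qed

end

section \<open>Unitary representations through their matrix coefficients\<close>

text \<open>The index set is an arbitrary finite set, so that direct sums and transversals can index
  matrices without being enumerated. Unitarity is the last clause: the adjoint of a matrix is its
  inverse.\<close>

definition matrix_rep :: "('a, 'b) monoid_scheme \<Rightarrow> 'i set \<Rightarrow> ('a \<Rightarrow> 'i \<Rightarrow> 'i \<Rightarrow> complex) \<Rightarrow> bool" where
  "matrix_rep G I u \<longleftrightarrow> finite I \<and> I \<noteq> {} \<and>
     (\<forall>g\<in>carrier G. \<forall>h\<in>carrier G. \<forall>i\<in>I. \<forall>j\<in>I. (\<Sum>k\<in>I. u g i k * u h k j) = u (g \<otimes>\<^bsub>G\<^esub> h) i j) \<and>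
     (\<forall>i\<in>I. \<forall>j\<in>I. u \<one>\<^bsub>G\<^esub> i j = (if i = j then 1 else 0)) \<and>
     (\<forall>g\<in>carrier G. \<forall>i\<in>I. \<forall>j\<in>I. u (inv\<^bsub>G\<^esub> g) i j = cnj (u g j i))"

lemma dim_mat_adjoint:
  "dim_row (mat_adjoint A) = dim_col A" "dim_col (mat_adjoint A) = dim_row A"
  by (simp_all add: mat_adjoint_def)

lemma mat_adjoint_index:
  fixes A :: "complex mat"
  assumes "i < dim_col A" "j < dim_row A"
  shows "mat_adjoint A $$ (i, j) = cnj (A $$ (j, i))"
  using assms by (simp add: mat_adjoint_def mat_of_rows_index)

lemma trace_of_fd_repI:
  assumes "group G" and u: "matrix_rep G I u"
    and \<tau>: "\<And>g. g \<in> carrier G \<Longrightarrow> \<tau> g = (\<Sum>i\<in>I. u g i i) / of_nat (card I)"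
  shows "trace_of_fd_rep G \<tau>"
proof -
  interpret group G by fact
  define n where "n = card I"
  have I: "finite I" "I \<noteq> {}"
    using u by (auto simp: matrix_rep_def)
  then have "n \<ge> 1"
    by (simp add: n_def Suc_le_eq card_gt_0_iff)
  obtain h where h: "bij_betw h {0..<n} I"
    using ex_bij_betw_nat_finite[OF I(1)] unfolding n_def by blast
  then have hI: "h i \<in> I" if "i < n" for i
    using that by (auto simp: bij_betw_def)
  have h_inj: "h i = h j \<longleftrightarrow> i = j" if "i < n" "j < n" for i j
    using h that by (auto simp: bij_betw_def inj_on_def)
  define \<pi> where "\<pi> = (\<lambda>g. Matrix.mat n n (\<lambda>(i, j). u g (h i) (h j)))"
  have dim [simp]: "\<pi> g \<in> carrier_mat n n" "dim_row (\<pi> g) = n" "dim_col (\<pi> g) = n" for g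
    by (simp_all add: \<pi>_def)
  have mult: "\<pi> g * \<pi> k = \<pi> (g \<otimes>\<^bsub>G\<^esub> k)" if "g \<in> carrier G" "k \<in> carrier G" for g k
  proof (rule eq_matI)
    fix i j assume "i < dim_row (\<pi> (g \<otimes>\<^bsub>G\<^esub> k))" "j < dim_col (\<pi> (g \<otimes>\<^bsub>G\<^esub> k))"
    then have ij: "i < n" "j < n"
      by auto
    then have "(\<pi> g * \<pi> k) $$ (i, j) = (\<Sum>l = 0..<n. u g (h i) (h l) * u k (h l) (h j))"
      by (simp add: \<pi>_def scalar_prod_def)
    also have "\<dots> = (\<Sum>l\<in>I. u g (h i) l * u k l (h j))"
      by (rule sum.reindex_bij_betw[OF h])
    also have "\<dots> = u (g \<otimes>\<^bsub>G\<^esub> k) (h i) (h j)"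
      using u that hI ij by (auto simp: matrix_rep_def)
    finally show "(\<pi> g * \<pi> k) $$ (i, j) = \<pi> (g \<otimes>\<^bsub>G\<^esub> k) $$ (i, j)"
      using ij by (simp add: \<pi>_def)
  qed simp_all
  have one: "\<pi> \<one>\<^bsub>G\<^esub> = 1\<^sub>m n"
    using u hI h_inj by (intro eq_matI) (auto simp: \<pi>_def matrix_rep_def)
  have adj: "mat_adjoint (\<pi> g) = \<pi> (inv\<^bsub>G\<^esub> g)" if "g \<in> carrier G" for g
    using u hI that
    by (intro eq_matI) (auto simp: dim_mat_adjoint mat_adjoint_index matrix_rep_def \<pi>_def)
  have "\<pi> \<in> hom G (unitary_group (ring_mat TYPE(complex) n ()) mat_adjoint)"
    by (rule homI) (auto simp: unitary_group_def ring_mat_def adj mult one)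
  moreover have "\<tau> g = normalized_trace (\<pi> g)" if "g \<in> carrier G" for g
  proof -
    have "(\<Sum>i\<in>I. u g i i) = (\<Sum>i = 0..<n. u g (h i) (h i))"
      by (rule sum.reindex_bij_betw[OF h, symmetric])
    then show ?thesis
      using \<tau>[OF that] by (simp add: normalized_trace_def \<pi>_def n_def lessThan_atLeast0)
  qed
  ultimately show ?thesis
    unfolding trace_of_fd_rep_def using \<open>n \<ge> 1\<close> by blast
qed

lemma trace_of_fd_repE:
  assumes "group G" "trace_of_fd_rep G \<tau>"
  obtains n u where "matrix_rep G {..<n::nat} u"
    "\<And>g. g \<in> carrier G \<Longrightarrow> \<tau> g = (\<Sum>i<n. u g i i) / of_nat n"
proof -
  interpret group G by fact
  obtain n \<pi> where n: "n \<ge> 1"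
    and \<pi>: "\<pi> \<in> hom G (unitary_group (ring_mat TYPE(complex) n ()) mat_adjoint)"
    and \<tau>: "\<And>g. g \<in> carrier G \<Longrightarrow> \<tau> g = normalized_trace (\<pi> g)"
    using assms(2) unfolding trace_of_fd_rep_def by blast
  have mult: "\<pi> (g \<otimes>\<^bsub>G\<^esub> h) = \<pi> g * \<pi> h" if "g \<in> carrier G" "h \<in> carrier G" for g h
    using hom_mult[OF \<pi> that] by (simp add: unitary_group_def ring_mat_def)
  have \<pi>_carrier: "\<pi> g \<in> carrier_mat n n" "mat_adjoint (\<pi> g) \<in> carrier_mat n n"
    and unitary: "mat_adjoint (\<pi> g) * \<pi> g = 1\<^sub>m n" "\<pi> g * mat_adjoint (\<pi> g) = 1\<^sub>m n"
    if "g \<in> carrier G" for g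
    using \<pi> that by (auto simp: hom_def unitary_group_def ring_mat_def)
  \<comment> \<open>\<open>hom\<close> asks only for multiplicativity; the image of the unit is an
    idempotent unitary and therefore the identity matrix.\<close>
  have one: "\<pi> \<one>\<^bsub>G\<^esub> = 1\<^sub>m n"
  proof -
    let ?p = "\<pi> \<one>\<^bsub>G\<^esub>"
    have "?p = (mat_adjoint ?p * ?p) * ?p"
      using \<pi>_carrier[of "\<one>\<^bsub>G\<^esub>"] by (simp add: unitary)
    also have "\<dots> = mat_adjoint ?p * (?p * ?p)"
      using \<pi>_carrier[of "\<one>\<^bsub>G\<^esub>"] by (intro assoc_mult_mat) auto
    also have "?p * ?p = ?p"
      using mult[of "\<one>\<^bsub>G\<^esub>" "\<one>\<^bsub>G\<^esub>"] by simp
    finally show ?thesis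
      by (simp add: unitary)
  qed
  have inv: "\<pi> (inv\<^bsub>G\<^esub> g) = mat_adjoint (\<pi> g)" if g: "g \<in> carrier G" for g
  proof -
    have "\<pi> (inv\<^bsub>G\<^esub> g) = \<pi> (inv\<^bsub>G\<^esub> g) * (\<pi> g * mat_adjoint (\<pi> g))"
      using \<pi>_carrier[of "inv\<^bsub>G\<^esub> g"] g by (simp add: unitary)
    also have "\<dots> = \<pi> (inv\<^bsub>G\<^esub> g) * \<pi> g * mat_adjoint (\<pi> g)"
      using \<pi>_carrier[of "inv\<^bsub>G\<^esub> g"] \<pi>_carrier[of g] g by (intro assoc_mult_mat[symmetric]) auto
    also have "\<pi> (inv\<^bsub>G\<^esub> g) * \<pi> g = 1\<^sub>m n"
      using mult[of "inv\<^bsub>G\<^esub> g" g] g one by simp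
    finally show ?thesis
      using \<pi>_carrier[of g] g by simp
  qed
  define u where "u = (\<lambda>g i j. \<pi> g $$ (i, j))"
  have "matrix_rep G {..<n} u"
    unfolding matrix_rep_def
  proof (intro conjI ballI)
    fix g h i j assume gh: "g \<in> carrier G" "h \<in> carrier G" and ij: "i \<in> {..<n}" "j \<in> {..<n}"
    have "u (g \<otimes>\<^bsub>G\<^esub> h) i j = (\<Sum>k = 0..<n. u g i k * u h k j)"
      using mult[OF gh] \<pi>_carrier(1)[OF gh(1)] \<pi>_carrier(1)[OF gh(2)] ij
      by (auto simp: u_def scalar_prod_def)
    then show "(\<Sum>k<n. u g i k * u h k j) = u (g \<otimes>\<^bsub>G\<^esub> h) i j"
      by (simp add: lessThan_atLeast0)
  next
    fix g i j assume g: "g \<in> carrier G" and ij: "i \<in> {..<n}" "j \<in> {..<n}"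
    then show "u (inv\<^bsub>G\<^esub> g) i j = cnj (u g j i)"
      using inv[OF g] \<pi>_carrier(1)[OF g] by (auto simp: u_def mat_adjoint_index)
  qed (use n one in \<open>auto simp: u_def lessThan_empty_iff\<close>)
  moreover have "\<tau> g = (\<Sum>i<n. u g i i) / of_nat n" if "g \<in> carrier G" for g
    using \<tau>[OF that] \<pi>_carrier(1)[OF that] by (auto simp: normalized_trace_def u_def)
  ultimately show ?thesis
    using that by blast
qed

text \<open>The rows of a unitary matrix are unit vectors, which bounds each diagonal entry by
  one.\<close>

lemma trace_of_fd_rep_norm_le_one:
  assumes "group G" "trace_of_fd_rep G \<tau>" "g \<in> carrier G"
  shows "cmod (\<tau> g) \<le> 1"
proof -
  interpret group G by fact
  obtain n u where u: "matrix_rep G {..<n::nat} u"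
    and \<tau>: "\<tau> g = (\<Sum>i<n. u g i i) / of_nat n"
    using trace_of_fd_repE[OF assms(1,2)] assms(3) by metis
  have "cmod (u g i i) \<le> 1" if "i < n" for i
  proof -
    have "(\<Sum>k<n. u g i k * u (inv\<^bsub>G\<^esub> g) k i) = u (g \<otimes>\<^bsub>G\<^esub> inv\<^bsub>G\<^esub> g) i i"
      using u assms(3) that unfolding matrix_rep_def by blast
    also have "\<dots> = 1"
      using u assms(3) that by (simp add: matrix_rep_def)
    also have "(\<Sum>k<n. u g i k * u (inv\<^bsub>G\<^esub> g) k i) = (\<Sum>k<n. of_real ((cmod (u g i k))\<^sup>2))"
      using u assms(3) that
      by (intro sum.cong refl) (simp add: matrix_rep_def complex_norm_square del: of_real_power)
    finally have "(\<Sum>k<n. (cmod (u g i k))\<^sup>2) = 1"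
      by (metis of_real_eq_1_iff of_real_sum)
    moreover have "(cmod (u g i i))\<^sup>2 \<le> (\<Sum>k<n. (cmod (u g i k))\<^sup>2)"
      using that by (intro member_le_sum) auto
    ultimately show ?thesis
      using abs_square_le_1[of "cmod (u g i i)"] by simp
  qed
  then have "cmod (\<Sum>i<n. u g i i) \<le> (\<Sum>i<n. 1)"
    by (intro sum_norm_le) auto
  then show ?thesis
    unfolding \<tau> by (auto simp: norm_divide divide_le_eq)
qed

text \<open>The midpoint is realised on \<open>n\<^sub>2\<close> copies of the first and \<open>n\<^sub>1\<close> copies of the second
  representation, of dimensions \<open>n\<^sub>1\<close> and \<open>n\<^sub>2\<close>, so that both carry the same weight.\<close>

lemma trace_of_fd_rep_midpoint:
  assumes "group G" "trace_of_fd_rep G \<sigma>\<^sub>1" "trace_of_fd_rep G \<sigma>\<^sub>2"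
  shows "trace_of_fd_rep G (\<lambda>g. (\<sigma>\<^sub>1 g + \<sigma>\<^sub>2 g) / 2)"
proof -
  interpret group G by fact
  obtain n\<^sub>1 u\<^sub>1 where u\<^sub>1: "matrix_rep G {..<n\<^sub>1::nat} u\<^sub>1"
    and \<sigma>\<^sub>1: "\<And>g. g \<in> carrier G \<Longrightarrow> \<sigma>\<^sub>1 g = (\<Sum>i<n\<^sub>1. u\<^sub>1 g i i) / of_nat n\<^sub>1"
    using trace_of_fd_repE[OF assms(1,2)] by metis
  obtain n\<^sub>2 u\<^sub>2 where u\<^sub>2: "matrix_rep G {..<n\<^sub>2::nat} u\<^sub>2"
    and \<sigma>\<^sub>2: "\<And>g. g \<in> carrier G \<Longrightarrow> \<sigma>\<^sub>2 g = (\<Sum>i<n\<^sub>2. u\<^sub>2 g i i) / of_nat n\<^sub>2"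
    using trace_of_fd_repE[OF assms(1,3)] by metis
  have n: "n\<^sub>1 > 0" "n\<^sub>2 > 0"
    using u\<^sub>1 u\<^sub>2 by (auto simp: matrix_rep_def)
  \<comment> \<open>The boolean selects the summand. In the first one \<open>i\<close> is the
    coordinate and \<open>k\<close> counts the copies; in the second one the roles are
    exchanged.\<close>
  define I where "I = {True, False} \<times> {..<n\<^sub>1} \<times> {..<n\<^sub>2}"
  define u where "u = (\<lambda>g (b, i, k) (b', j, l). if b \<noteq> b' then 0
     else if b then (if k = l then u\<^sub>1 g i j else 0) else (if i = j then u\<^sub>2 g k l else 0))"
  have sum_I: "sum f I = (\<Sum>i<n\<^sub>1. \<Sum>k<n\<^sub>2. f (True, i, k)) + (\<Sum>k<n\<^sub>2. \<Sum>i<n\<^sub>1. f (False, i, k))"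
    for f :: "_ \<Rightarrow> complex"
  proof -
    have "sum f I = (\<Sum>b\<in>{True, False}. \<Sum>x\<in>{..<n\<^sub>1} \<times> {..<n\<^sub>2}. f (b, x))"
      unfolding I_def sum.cartesian_product by (simp add: split_def)
    also have "\<dots> = (\<Sum>x\<in>{..<n\<^sub>1} \<times> {..<n\<^sub>2}. f (True, x)) + (\<Sum>x\<in>{..<n\<^sub>1} \<times> {..<n\<^sub>2}. f (False, x))"
      by simp
    also have "(\<Sum>x\<in>{..<n\<^sub>1} \<times> {..<n\<^sub>2}. f (False, x)) = (\<Sum>i<n\<^sub>1. \<Sum>k<n\<^sub>2. f (False, i, k))"
      by (simp add: sum.cartesian_product split_def)
    also have "\<dots> = (\<Sum>k<n\<^sub>2. \<Sum>i<n\<^sub>1. f (False, i, k))"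
      by (rule sum.swap)
    finally show ?thesis
      by (simp add: sum.cartesian_product split_def)
  qed
  have card_I: "card I = 2 * n\<^sub>1 * n\<^sub>2"
    by (simp add: I_def card_cartesian_product)
  have "matrix_rep G I u"
    unfolding matrix_rep_def
  proof (intro conjI ballI)
    show "finite I" "I \<noteq> {}"
      using n by (auto simp: I_def)
  next
    fix g h p q assume gh: "g \<in> carrier G" "h \<in> carrier G" and pq: "p \<in> I" "q \<in> I"
    obtain b i k b' j l where p: "p = (b, i, k)" and q: "q = (b', j, l)"
      by (metis prod_cases3)
    have ik: "i < n\<^sub>1" "k < n\<^sub>2" "j < n\<^sub>1" "l < n\<^sub>2"
      using pq by (auto simp: I_def p q)
    have 1: "(\<Sum>m<n\<^sub>1. u\<^sub>1 g i m * u\<^sub>1 h m j) = u\<^sub>1 (g \<otimes>\<^bsub>G\<^esub> h) i j"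
      using u\<^sub>1 gh ik unfolding matrix_rep_def by blast
    have 2: "(\<Sum>m<n\<^sub>2. u\<^sub>2 g k m * u\<^sub>2 h m l) = u\<^sub>2 (g \<otimes>\<^bsub>G\<^esub> h) k l"
      using u\<^sub>2 gh ik unfolding matrix_rep_def by blast
    show "(\<Sum>r\<in>I. u g p r * u h r q) = u (g \<otimes>\<^bsub>G\<^esub> h) p q"
      unfolding sum_I p q u_def using ik
      by (cases b; cases b')
        (auto simp: if_distrib[of "\<lambda>x. _ * x"] if_distrib[of "\<lambda>x. x * _"] sum.If_cases 1 2 cong: if_cong)
  next
    fix p q assume "p \<in> I" "q \<in> I"
    moreover have "u\<^sub>1 \<one>\<^bsub>G\<^esub> i j = (if i = j then 1 else 0)" if "i < n\<^sub>1" "j < n\<^sub>1" for i j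
      using u\<^sub>1 that by (auto simp: matrix_rep_def)
    moreover have "u\<^sub>2 \<one>\<^bsub>G\<^esub> i j = (if i = j then 1 else 0)" if "i < n\<^sub>2" "j < n\<^sub>2" for i j
      using u\<^sub>2 that by (auto simp: matrix_rep_def)
    ultimately show "u \<one>\<^bsub>G\<^esub> p q = (if p = q then 1 else 0)"
      by (auto simp: I_def u_def split: if_splits)
  next
    fix g p q assume "g \<in> carrier G" "p \<in> I" "q \<in> I"
    moreover have "u\<^sub>1 (inv\<^bsub>G\<^esub> g) i j = cnj (u\<^sub>1 g j i)" if "i < n\<^sub>1" "j < n\<^sub>1" for i j
      using u\<^sub>1 that \<open>g \<in> carrier G\<close> by (auto simp: matrix_rep_def)
    moreover have "u\<^sub>2 (inv\<^bsub>G\<^esub> g) i j = cnj (u\<^sub>2 g j i)" if "i < n\<^sub>2" "j < n\<^sub>2" for i j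
      using u\<^sub>2 that \<open>g \<in> carrier G\<close> by (auto simp: matrix_rep_def)
    ultimately show "u (inv\<^bsub>G\<^esub> g) p q = cnj (u g q p)"
      by (auto simp: I_def u_def split: if_splits)
  qed
  moreover have "(\<sigma>\<^sub>1 g + \<sigma>\<^sub>2 g) / 2 = (\<Sum>p\<in>I. u g p p) / of_nat (card I)" if "g \<in> carrier G" for g
    unfolding sum_I card_I \<sigma>\<^sub>1[OF that] \<sigma>\<^sub>2[OF that] u_def
    using n by (simp add: field_simps sum_distrib_left sum_distrib_right)
  ultimately show ?thesis
    by (rule trace_of_fd_repI[OF assms(1)])
qed

text \<open>This is the representation induced from the homomorphism \<open>\<omega>\<close> on its support, written out
  in a transversal \<open>R\<close> of the support.\<close>

lemma trace_of_fd_rep_of_multiplicative: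
  assumes "group G" and \<omega>_one: "\<omega> \<one>\<^bsub>G\<^esub> = 1"
    and mult: "\<And>g h. g \<in> carrier G \<Longrightarrow> h \<in> carrier G \<Longrightarrow> \<omega> g \<noteq> 0 \<Longrightarrow> \<omega> (g \<otimes>\<^bsub>G\<^esub> h) = \<omega> g * \<omega> h"
    and norm: "\<And>g. g \<in> carrier G \<Longrightarrow> \<omega> g \<noteq> 0 \<Longrightarrow> cmod (\<omega> g) = 1"
    and class_fun: "\<And>g h. g \<in> carrier G \<Longrightarrow> h \<in> carrier G \<Longrightarrow> \<omega> (h \<otimes>\<^bsub>G\<^esub> g \<otimes>\<^bsub>G\<^esub> inv\<^bsub>G\<^esub> h) = \<omega> g"
    and finite_index: "finite (\<phi> ` carrier G)"
      "\<And>g h. g \<in> carrier G \<Longrightarrow> h \<in> carrier G \<Longrightarrow> \<phi> g = \<phi> h \<Longrightarrow> \<omega> (inv\<^bsub>G\<^esub> g \<otimes>\<^bsub>G\<^esub> h) \<noteq> 0"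
  shows "trace_of_fd_rep G \<omega>"
proof -
  interpret group G by fact
  have \<omega>_inv: "\<omega> (inv\<^bsub>G\<^esub> g) = cnj (\<omega> g)" if g: "g \<in> carrier G" for g
  proof -
    have nz: "\<omega> (inv\<^bsub>G\<^esub> g) = cnj (\<omega> g)" if "\<omega> g \<noteq> 0" "g \<in> carrier G" for g
    proof -
      have "\<omega> g * \<omega> (inv\<^bsub>G\<^esub> g) = 1"
        using mult[of g "inv\<^bsub>G\<^esub> g"] that \<omega>_one by simp
      moreover have "\<omega> g * cnj (\<omega> g) = 1"
        using norm[OF that(2,1)] by (simp flip: complex_norm_square)
      ultimately show ?thesis
        using that(1) by (metis mult_left_cancel)
    qed
    show ?thesis
      using nz[OF _ g] nz[of "inv\<^bsub>G\<^esub> g"] g by (cases "\<omega> g = 0") auto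
  qed
  \<comment> \<open>Passing to inverses, where \<open>\<omega>\<close> becomes its conjugate, moves
    the nonvanishing condition from the left factor to the right one.\<close>
  have mult': "\<omega> (g \<otimes>\<^bsub>G\<^esub> h) = \<omega> g * \<omega> h" if "g \<in> carrier G" "h \<in> carrier G" "\<omega> h \<noteq> 0" for g h
  proof -
    have "\<omega> (inv\<^bsub>G\<^esub> h \<otimes>\<^bsub>G\<^esub> inv\<^bsub>G\<^esub> g) = \<omega> (inv\<^bsub>G\<^esub> h) * \<omega> (inv\<^bsub>G\<^esub> g)"
      using that by (intro mult) (auto simp: \<omega>_inv)
    then have "cnj (\<omega> (g \<otimes>\<^bsub>G\<^esub> h)) = cnj (\<omega> g * \<omega> h)"
      using that by (simp flip: inv_mult_group add: \<omega>_inv mult.commute)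
    then show ?thesis
      by (metis complex_cnj_cancel_iff)
  qed
  \<comment> \<open>This relates points in the same left coset of the support of
    \<open>\<omega>\<close>, which is a subgroup.\<close>
  define r where "r = {(g, h). g \<in> carrier G \<and> h \<in> carrier G \<and> \<omega> (inv\<^bsub>G\<^esub> g \<otimes>\<^bsub>G\<^esub> h) \<noteq> 0}"
  have cancel0: "b \<otimes>\<^bsub>G\<^esub> (inv\<^bsub>G\<^esub> b \<otimes>\<^bsub>G\<^esub> c) = c" if "b \<in> carrier G" "c \<in> carrier G" for b c
    using that by (simp flip: m_assoc)
  have cancel: "(inv\<^bsub>G\<^esub> a \<otimes>\<^bsub>G\<^esub> b) \<otimes>\<^bsub>G\<^esub> (inv\<^bsub>G\<^esub> b \<otimes>\<^bsub>G\<^esub> c) = inv\<^bsub>G\<^esub> a \<otimes>\<^bsub>G\<^esub> c"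
    if "a \<in> carrier G" "b \<in> carrier G" "c \<in> carrier G" for a b c
    using that by (simp add: m_assoc cancel0)
  have r: "equiv (carrier G) r"
  proof (rule equivI)
    show "sym r"
    proof (rule symI)
      fix g h assume "(g, h) \<in> r"
      then show "(h, g) \<in> r"
        using \<omega>_inv[of "inv\<^bsub>G\<^esub> g \<otimes>\<^bsub>G\<^esub> h"] by (auto simp: r_def inv_mult_group)
    qed
    show "trans r"
    proof (rule transI)
      fix a b c assume "(a, b) \<in> r" "(b, c) \<in> r"
      then show "(a, c) \<in> r"
        using mult[of "inv\<^bsub>G\<^esub> a \<otimes>\<^bsub>G\<^esub> b" "inv\<^bsub>G\<^esub> b \<otimes>\<^bsub>G\<^esub> c"] cancel[of a b c] by (auto simp: r_def)
    qed
  qed (auto simp: r_def refl_on_def \<omega>_one)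
  define R where "R = (\<lambda>X. SOME x. x \<in> X) ` (carrier G // r)"
  have rep: "(SOME x. x \<in> X) \<in> X" if "X \<in> carrier G // r" for X
    using in_quotient_imp_non_empty[OF r that] by (simp add: some_in_eq)
  have R_carrier: "x \<in> carrier G" if "x \<in> R" for x
    using that rep in_quotient_imp_subset[OF r] by (auto simp: R_def)
  have R_unique: "x = y" if xy: "x \<in> R" "y \<in> R" "(x, y) \<in> r" for x y
  proof -
    obtain X Y where X: "X \<in> carrier G // r" "x = (SOME x. x \<in> X)"
      and Y: "Y \<in> carrier G // r" "y = (SOME x. x \<in> Y)"
      using xy(1,2) by (auto simp: R_def)
    then have "X = Y"
      using xy(3) rep by (intro quotient_eqI[OF r, of X Y x y]) auto
    then show ?thesis
      using X Y by simp
  qed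
  have R_cover: "\<exists>x\<in>R. (x, g) \<in> r" if "g \<in> carrier G" for g
  proof -
    have X: "r `` {g} \<in> carrier G // r"
      using that by (rule quotientI)
    then have "(g, SOME x. x \<in> r `` {g}) \<in> r"
      using rep by blast
    then have "((SOME x. x \<in> r `` {g}), g) \<in> r"
      using r by (meson equivE symD)
    then show ?thesis
      using X unfolding R_def by blast
  qed
  have "finite R"
  proof -
    have "inj_on \<phi> R"
      using R_unique finite_index(2) R_carrier by (auto simp: inj_on_def r_def)
    moreover have "finite (\<phi> ` R)"
      using finite_index(1) by (rule finite_subset[rotated]) (use R_carrier in auto)
    ultimately show ?thesis
      by (simp add: finite_image_iff)
  qed
  moreover have "R \<noteq> {}"
    using R_cover[of "\<one>\<^bsub>G\<^esub>"] by auto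
  moreover have "(\<Sum>k\<in>R. \<omega> (inv\<^bsub>G\<^esub> i \<otimes>\<^bsub>G\<^esub> g \<otimes>\<^bsub>G\<^esub> k) * \<omega> (inv\<^bsub>G\<^esub> k \<otimes>\<^bsub>G\<^esub> h \<otimes>\<^bsub>G\<^esub> j)) =
      \<omega> (inv\<^bsub>G\<^esub> i \<otimes>\<^bsub>G\<^esub> (g \<otimes>\<^bsub>G\<^esub> h) \<otimes>\<^bsub>G\<^esub> j)"
    if gh: "g \<in> carrier G" "h \<in> carrier G" and ij: "i \<in> R" "j \<in> R" for g h i j
  proof -
    have [simp]: "i \<in> carrier G" "j \<in> carrier G"
      using ij R_carrier by auto
    obtain l where l: "l \<in> R" "(l, h \<otimes>\<^bsub>G\<^esub> j) \<in> r"
      using R_cover[of "h \<otimes>\<^bsub>G\<^esub> j"] gh by auto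
    \<comment> \<open>Only the representative \<open>l\<close> of the coset of \<open>h j\<close>
      contributes: the matrices are monomial, with one nonzero entry in each column.\<close>
    have "\<omega> (inv\<^bsub>G\<^esub> k \<otimes>\<^bsub>G\<^esub> h \<otimes>\<^bsub>G\<^esub> j) = 0" if "k \<in> R - {l}" for k
    proof (rule ccontr)
      assume "\<omega> (inv\<^bsub>G\<^esub> k \<otimes>\<^bsub>G\<^esub> h \<otimes>\<^bsub>G\<^esub> j) \<noteq> 0"
      then have "(k, h \<otimes>\<^bsub>G\<^esub> j) \<in> r"
        using that R_carrier[of k] gh by (simp add: r_def m_assoc)
      then have "(k, l) \<in> r"
        using l(2) r unfolding equiv_def sym_def trans_def by blast
      then show False
        using R_unique[of k l] that l(1) by blast
    qed
    then have "(\<Sum>k\<in>R. \<omega> (inv\<^bsub>G\<^esub> i \<otimes>\<^bsub>G\<^esub> g \<otimes>\<^bsub>G\<^esub> k) * \<omega> (inv\<^bsub>G\<^esub> k \<otimes>\<^bsub>G\<^esub> h \<otimes>\<^bsub>G\<^esub> j)) =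
        (\<Sum>k\<in>{l}. \<omega> (inv\<^bsub>G\<^esub> i \<otimes>\<^bsub>G\<^esub> g \<otimes>\<^bsub>G\<^esub> k) * \<omega> (inv\<^bsub>G\<^esub> k \<otimes>\<^bsub>G\<^esub> h \<otimes>\<^bsub>G\<^esub> j))"
      using \<open>finite R\<close> l(1) by (intro sum.mono_neutral_right) auto
    also have "\<dots> = \<omega> (inv\<^bsub>G\<^esub> i \<otimes>\<^bsub>G\<^esub> g \<otimes>\<^bsub>G\<^esub> l \<otimes>\<^bsub>G\<^esub> (inv\<^bsub>G\<^esub> l \<otimes>\<^bsub>G\<^esub> h \<otimes>\<^bsub>G\<^esub> j))"
      using mult'[of "inv\<^bsub>G\<^esub> i \<otimes>\<^bsub>G\<^esub> g \<otimes>\<^bsub>G\<^esub> l" "inv\<^bsub>G\<^esub> l \<otimes>\<^bsub>G\<^esub> h \<otimes>\<^bsub>G\<^esub> j"] l(2) R_carrier[OF l(1)] gh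
      by (simp add: r_def m_assoc)
    also have "inv\<^bsub>G\<^esub> i \<otimes>\<^bsub>G\<^esub> g \<otimes>\<^bsub>G\<^esub> l \<otimes>\<^bsub>G\<^esub> (inv\<^bsub>G\<^esub> l \<otimes>\<^bsub>G\<^esub> h \<otimes>\<^bsub>G\<^esub> j) = inv\<^bsub>G\<^esub> i \<otimes>\<^bsub>G\<^esub> (g \<otimes>\<^bsub>G\<^esub> h) \<otimes>\<^bsub>G\<^esub> j"
      using R_carrier[OF l(1)] gh by (simp add: m_assoc cancel0)
    finally show ?thesis .
  qed
  moreover have "\<omega> (inv\<^bsub>G\<^esub> i \<otimes>\<^bsub>G\<^esub> \<one>\<^bsub>G\<^esub> \<otimes>\<^bsub>G\<^esub> j) = (if i = j then 1 else 0)" if "i \<in> R" "j \<in> R" for i j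
    using R_unique[OF that] R_carrier that \<omega>_one by (auto simp: r_def)
  moreover have "\<omega> (inv\<^bsub>G\<^esub> i \<otimes>\<^bsub>G\<^esub> inv\<^bsub>G\<^esub> g \<otimes>\<^bsub>G\<^esub> j) = cnj (\<omega> (inv\<^bsub>G\<^esub> j \<otimes>\<^bsub>G\<^esub> g \<otimes>\<^bsub>G\<^esub> i))"
    if "g \<in> carrier G" "i \<in> R" "j \<in> R" for g i j
    using R_carrier that by (simp flip: \<omega>_inv add: inv_mult_group m_assoc)
  ultimately have "matrix_rep G R (\<lambda>g i j. \<omega> (inv\<^bsub>G\<^esub> i \<otimes>\<^bsub>G\<^esub> g \<otimes>\<^bsub>G\<^esub> j))"
    by (simp add: matrix_rep_def)
  \<comment> \<open>Invariance under conjugation makes every diagonal entry equal to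
    \<open>\<omega> g\<close>, so the normalized trace returns \<open>\<omega>\<close>
    itself.\<close>
  moreover have "\<omega> g = (\<Sum>i\<in>R. \<omega> (inv\<^bsub>G\<^esub> i \<otimes>\<^bsub>G\<^esub> g \<otimes>\<^bsub>G\<^esub> i)) / of_nat (card R)"
    if "g \<in> carrier G" for g
  proof -
    have "\<omega> (inv\<^bsub>G\<^esub> i \<otimes>\<^bsub>G\<^esub> g \<otimes>\<^bsub>G\<^esub> i) = \<omega> g" if "i \<in> R" for i
      using class_fun[OF \<open>g \<in> carrier G\<close>, of "inv\<^bsub>G\<^esub> i"] R_carrier[OF that] by simp
    then show ?thesis
      using \<open>finite R\<close> \<open>R \<noteq> {}\<close> by simp
  qed
  ultimately show ?thesis
    by (rule trace_of_fd_repI[OF assms(1)])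
qed

section \<open>Folner sets in the center from polynomial growth\<close>

text \<open>If every step from 1 on increased \<open>f\<close> by more than the factor
  \<open>1 + \<epsilon>\<close>, its growth would be exponential, against the polynomial
  bound.\<close>

lemma exists_slow_growth_step:
  fixes f :: "nat \<Rightarrow> real"
  assumes "\<epsilon> > 0" "f 1 \<ge> 1" "\<And>k. f k \<le> real k ^ m"
  obtains k where "k \<ge> 1" "f (Suc k) \<le> (1 + \<epsilon>) * f k"
proof (rule ccontr)
  assume "\<not> thesis"
  then have step: "f (Suc k) \<ge> (1 + \<epsilon>) * f k" if "k \<ge> 1" for k
    using that \<open>\<And>k. k \<ge> 1 \<Longrightarrow> f (Suc k) \<le> (1 + \<epsilon>) * f k \<Longrightarrow> thesis\<close> by (meson linear)
  have "(1 + \<epsilon>) ^ k \<le> f (Suc k)" for k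
  proof (induction k)
    case (Suc k)
    then have "(1 + \<epsilon>) * (1 + \<epsilon>) ^ k \<le> (1 + \<epsilon>) * f (Suc k)"
      using assms(1) by (intro mult_left_mono) auto
    then show ?case
      using step[of "Suc k"] by simp
  qed (use assms(2) in simp)
  then have "(1 + \<epsilon>) ^ k \<le> real (Suc k) ^ m" for k
    using assms(3) order_trans by blast
  moreover have "eventually (\<lambda>k. real (Suc k) ^ m < (1 + \<epsilon>) ^ k) sequentially"
    using assms(1) by real_asymp
  then have "\<exists>k. real (Suc k) ^ m < (1 + \<epsilon>) ^ k"
    by (rule eventually_happens'[OF sequentially_bot])
  ultimately show False
    by (meson not_less)
qed

context group
begin

lemma mult_in_group_center:
  assumes "x \<in> group_center G" "y \<in> group_center G"
  shows "x \<otimes> y \<in> group_center G"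
proof -
  have xy: "x \<in> carrier G" "y \<in> carrier G"
    using assms by (auto simp: group_center_def)
  have "x \<otimes> y \<otimes> g = g \<otimes> (x \<otimes> y)" if g: "g \<in> carrier G" for g
  proof -
    have "x \<otimes> y \<otimes> g = x \<otimes> g \<otimes> y"
      using group_center_commute[OF assms(2) g] xy g by (simp add: m_assoc)
    then show ?thesis
      using group_center_commute[OF assms(1) g] xy g by (simp add: m_assoc)
  qed
  then show ?thesis
    using xy by (simp add: group_center_def)
qed

text \<open>\<open>P k\<close> is the box of all products of powers of the elements of
  \<open>E\<close> with exponents below \<open>k\<close>, and the cardinality bound counts exponent
  vectors. As the center is commutative, multiplying by an element of \<open>E\<close> raises a
  single exponent, which leads into the next box. The induction adds one element, and with it one
  exponent, at a time.\<close>

lemma center_polynomial_growth: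
  assumes "finite E" "E \<subseteq> group_center G"
  shows "\<exists>P :: nat \<Rightarrow> 'a set. \<forall>k. finite (P k) \<and> card (P k) \<le> k ^ card E \<and> P k \<subseteq> group_center G \<and>
    (k \<ge> 1 \<longrightarrow> P k \<noteq> {}) \<and> P k \<subseteq> P (Suc k) \<and> (\<forall>z\<in>E. \<forall>a\<in>P k. z \<otimes> a \<in> P (Suc k))"
  using assms
proof (induction E)
  case empty
  have "\<one> \<in> group_center G"
    by (simp add: group_center_def)
  then show ?case
    by (intro exI[where x = "\<lambda>_. {\<one>}"]) simp
next
  case (insert z E)
  have center_carrier: "x \<in> carrier G" if "x \<in> group_center G" for x
    using that by (simp add: group_center_def)
  have E: "E \<subseteq> group_center G"
    using insert.prems by simp
  obtain P :: "nat \<Rightarrow> 'a set" where "\<forall>k. finite (P k) \<and> card (P k) \<le> k ^ card E \<and> P k \<subseteq> group_center G \<and>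
    (k \<ge> 1 \<longrightarrow> P k \<noteq> {}) \<and> P k \<subseteq> P (Suc k) \<and> (\<forall>z\<in>E. \<forall>a\<in>P k. z \<otimes> a \<in> P (Suc k))"
    using insert.IH[OF E] by (rule exE)
  then have P: "finite (P k)" "card (P k) \<le> k ^ card E" "P k \<subseteq> group_center G"
      "k \<ge> 1 \<Longrightarrow> P k \<noteq> {}" "P k \<subseteq> P (Suc k)"
    and P_mult: "\<And>z a. z \<in> E \<Longrightarrow> a \<in> P k \<Longrightarrow> z \<otimes> a \<in> P (Suc k)" for k
    by simp_all
  have z: "z \<in> carrier G" "z \<in> group_center G"
    using insert.prems by (auto simp: center_carrier)
  have pow: "z [^] (i::nat) \<in> group_center G" for i
    by (induction i) (auto simp: mult_in_group_center z, simp add: group_center_def)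
  define P' where "P' = (\<lambda>k. (\<lambda>(i, a). z [^] i \<otimes> a) ` ({..<k} \<times> P k))"
  have P'I: "z [^] i \<otimes> a \<in> P' k" if "i < k" "a \<in> P k" for i a k
    using that by (auto simp: P'_def intro!: rev_image_eqI[of "(i, a)"])
  have "finite (P' k)" for k
    using P(1) by (simp add: P'_def)
  moreover have "card (P' k) \<le> k ^ card (insert z E)" for k
  proof -
    have "card (P' k) \<le> card ({..<k} \<times> P k)"
      unfolding P'_def using P(1) by (intro card_image_le) simp
    also have "\<dots> \<le> k * k ^ card E"
      using P(2) by (simp add: card_cartesian_product)
    finally show ?thesis
      using insert.hyps by simp
  qed
  moreover have "P' k \<subseteq> group_center G" for k
    using P(3)[of k] pow mult_in_group_center by (auto simp: P'_def)
  moreover have "P' k \<noteq> {}" if "k \<ge> 1" for k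
    using P(4)[OF that] that by (auto simp: P'_def lessThan_empty_iff)
  moreover have "P' k \<subseteq> P' (Suc k)" for k
    using P(5)[of k] by (auto simp: P'_def less_Suc_eq)
  moreover have "y \<otimes> a \<in> P' (Suc k)" if y: "y \<in> insert z E" and a: "a \<in> P' k" for y a k
  proof -
    obtain i b where b: "i < k" "b \<in> P k" "a = z [^] i \<otimes> b"
      using a by (auto simp: P'_def)
    have b_carrier: "b \<in> carrier G"
      using b P(3) center_carrier by blast
    show ?thesis
    proof (cases "y = z")
      case True
      then have "y \<otimes> a = z [^] Suc i \<otimes> b"
        using group_center_commute[OF pow z(1), of i] z b(3) b_carrier by (simp flip: m_assoc)
      then show ?thesis
        using P'I[of "Suc i" "Suc k" b] b P(5)[of k] by auto
    next
      case False
      then have "y \<in> E" "y \<in> carrier G"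
        using y insert.prems center_carrier by auto
      then have "y \<otimes> a = z [^] i \<otimes> (y \<otimes> b)"
        using group_center_commute[OF pow, of y i] b(3) b_carrier z by (simp flip: m_assoc)
      then show ?thesis
        using P'I[of i "Suc k" "y \<otimes> b"] b P_mult[OF \<open>y \<in> E\<close> b(2)] by auto
    qed
  qed
  ultimately have "\<forall>k. finite (P' k) \<and> card (P' k) \<le> k ^ card (insert z E) \<and> P' k \<subseteq> group_center G \<and>
    (k \<ge> 1 \<longrightarrow> P' k \<noteq> {}) \<and> P' k \<subseteq> P' (Suc k) \<and> (\<forall>y\<in>insert z E. \<forall>a\<in>P' k. y \<otimes> a \<in> P' (Suc k))"
    by (simp only: simp_thms) blast
  then show ?case
    by (rule exI[of _ P'])
qed

text \<open>A box that grows little at the next step is a Folner set: a translate that leaves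
  \<open>P k\<close> lands in \<open>P (Suc k) - P k\<close>, and translation is injective.\<close>

lemma center_Folner_set:
  assumes "finite E" "E \<subseteq> group_center G" "\<epsilon> > 0"
  obtains A where "finite A" "A \<noteq> {}" "A \<subseteq> group_center G"
    "\<And>z. z \<in> E \<Longrightarrow> real (card {a \<in> A. z \<otimes> a \<notin> A}) \<le> \<epsilon> * real (card A)"
proof -
  obtain P :: "nat \<Rightarrow> 'a set" where "\<forall>k. finite (P k) \<and> card (P k) \<le> k ^ card E \<and> P k \<subseteq> group_center G \<and>
    (k \<ge> 1 \<longrightarrow> P k \<noteq> {}) \<and> P k \<subseteq> P (Suc k) \<and> (\<forall>z\<in>E. \<forall>a\<in>P k. z \<otimes> a \<in> P (Suc k))"
    using center_polynomial_growth[OF assms(1,2)] by (rule exE)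
  then have P: "finite (P k)" "card (P k) \<le> k ^ card E" "P k \<subseteq> group_center G"
      "k \<ge> 1 \<Longrightarrow> P k \<noteq> {}" "P k \<subseteq> P (Suc k)"
    and P_mult: "\<And>z a. z \<in> E \<Longrightarrow> a \<in> P k \<Longrightarrow> z \<otimes> a \<in> P (Suc k)" for k
    by simp_all
  have "real (card (P 1)) \<ge> 1"
    using P(1,4)[of 1] by (simp add: Suc_le_eq card_gt_0_iff)
  moreover have "real (card (P k)) \<le> real k ^ card E" for k
    using P(2)[of k] by (metis of_nat_le_iff of_nat_power)
  ultimately obtain k where k: "k \<ge> 1" "real (card (P (Suc k))) \<le> (1 + \<epsilon>) * real (card (P k))"
    using exists_slow_growth_step[OF assms(3), of "\<lambda>k. real (card (P k))" "card E"] by blast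
  show ?thesis
  proof (rule that[of "P k"])
    fix z assume z: "z \<in> E"
    then have z_carrier: "z \<in> carrier G"
      using assms(2) by (auto simp: group_center_def)
    have "inj_on ((\<otimes>) z) {a \<in> P k. z \<otimes> a \<notin> P k}"
      using P(3) z_carrier by (auto simp: inj_on_def group_center_def subset_iff)
    then have "card {a \<in> P k. z \<otimes> a \<notin> P k} = card ((\<otimes>) z ` {a \<in> P k. z \<otimes> a \<notin> P k})"
      by (simp add: card_image)
    also have "\<dots> \<le> card (P (Suc k) - P k)"
      using P(1) P_mult[OF z] by (intro card_mono) auto
    also have "\<dots> = card (P (Suc k)) - card (P k)"
      using P(1,5) by (intro card_Diff_subset)
    finally have "real (card {a \<in> P k. z \<otimes> a \<notin> P k}) \<le> real (card (P (Suc k))) - real (card (P k))"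
      using card_mono[OF P(1,5)] by (metis of_nat_diff of_nat_le_iff)
    then show "real (card {a \<in> P k. z \<otimes> a \<notin> P k}) \<le> \<epsilon> * real (card (P k))"
      using k(2) by (simp add: algebra_simps)
  qed (use P k in auto)
qed

section \<open>Finite quotients and positive definite functions on finite abelian groups\<close>

text \<open>The product of homomorphisms that separate single pairs separates them all;
  \<open>prod_encode\<close> carries the direct product back to a group on the naturals.\<close>

lemma residually_finite_separation:
  assumes "residually_finite G" "finite S"
    and "\<And>x y. (x, y) \<in> S \<Longrightarrow> x \<in> carrier G \<and> y \<in> carrier G \<and> x \<noteq> y"
  shows "\<exists>(H :: nat monoid) \<phi>. group H \<and> finite (carrier H) \<and> \<phi> \<in> hom G H \<and>
    (\<forall>(x, y)\<in>S. \<phi> x \<noteq> \<phi> y)"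
  using assms(2,3)
proof (induction S)
  case empty
  show ?case
    by (rule exI[of _ "\<lparr>carrier = {0}, monoid.mult = \<lambda>_ _. 0, one = 0\<rparr>"], rule exI[of _ "\<lambda>_. 0"])
      (auto simp: hom_def intro!: groupI)
next
  case (insert p S)
  obtain H\<^sub>1 :: "nat monoid" and \<phi>\<^sub>1 where 1: "group H\<^sub>1" "finite (carrier H\<^sub>1)" "\<phi>\<^sub>1 \<in> hom G H\<^sub>1"
    "\<forall>(x, y)\<in>S. \<phi>\<^sub>1 x \<noteq> \<phi>\<^sub>1 y"
    using insert.IH insert.prems by (meson insertI2)
  have p: "fst p \<in> carrier G" "snd p \<in> carrier G" "fst p \<noteq> snd p"
    using insert.prems[of "fst p" "snd p"] by auto
  obtain H\<^sub>2 :: "nat monoid" and \<phi>\<^sub>2 where 2: "group H\<^sub>2" "finite (carrier H\<^sub>2)" "\<phi>\<^sub>2 \<in> hom G H\<^sub>2"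
    "\<phi>\<^sub>2 (fst p) \<noteq> \<phi>\<^sub>2 (snd p)"
    using assms(1)[unfolded residually_finite_def, rule_format, OF p] by blast
  define H where "H = image_group prod_encode (H\<^sub>1 \<times>\<times> H\<^sub>2)"
  have inj: "inj_on prod_encode (carrier (H\<^sub>1 \<times>\<times> H\<^sub>2))"
    by (rule inj_prod_encode)
  have DP: "group (H\<^sub>1 \<times>\<times> H\<^sub>2)"
    using 1(1) 2(1) by (rule DirProd_group)
  have "group H"
    unfolding H_def using group.inj_imp_image_group_is_group[OF DP inj] .
  moreover have "finite (carrier H)"
    unfolding H_def image_group_carrier using 1(2) 2(2) by simp
  moreover have "(\<lambda>x. prod_encode (\<phi>\<^sub>1 x, \<phi>\<^sub>2 x)) \<in> hom G H"
  proof -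
    have 3: "(\<lambda>x. (\<phi>\<^sub>1 x, \<phi>\<^sub>2 x)) \<in> hom G (H\<^sub>1 \<times>\<times> H\<^sub>2)"
      using 1(3) 2(3) by (auto simp: hom_def)
    have 4: "prod_encode \<in> hom (H\<^sub>1 \<times>\<times> H\<^sub>2) H"
      using inj_imp_image_group_iso[OF inj] by (simp add: iso_def H_def)
    show ?thesis
      using 3 4 by (auto simp: hom_def Pi_iff)
  qed
  moreover have "\<forall>(x, y)\<in>insert p S. prod_encode (\<phi>\<^sub>1 x, \<phi>\<^sub>2 x) \<noteq> prod_encode (\<phi>\<^sub>1 y, \<phi>\<^sub>2 y)"
    using 1(4) 2(4) by (auto simp: prod_encode_eq)
  ultimately show ?case
    by blast
qed

text \<open>This is the vector state of the regular representation at the unit vector that takes the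
  value \<open>cnj (\<theta> a) / sqrt (card A)\<close> at \<open>f a\<close>.\<close>

lemma group_character_of_vector:
  assumes "finite (carrier G)" and comm: "\<And>x y. x \<in> carrier G \<Longrightarrow> y \<in> carrier G \<Longrightarrow> x \<otimes> y = y \<otimes> x"
    and A: "finite A" "A \<noteq> {}" and f: "f ` A \<subseteq> carrier G" "inj_on f A"
    and \<theta>: "\<And>a. a \<in> A \<Longrightarrow> cmod (\<theta> a) = 1"
  shows "group_character G (\<lambda>q. (\<Sum>b\<in>A. \<Sum>a\<in>A. if q \<otimes> f a = f b then cnj (\<theta> a) * \<theta> b else 0) / of_nat (card A))"
    (is "group_character G (\<lambda>q. ?S q / _)")
proof -
  have fc: "f a \<in> carrier G" if "a \<in> A" for a
    using f that by blast
  have "(\<Sum>i<n. \<Sum>j<n. cnj (c i) * c j * (?S (inv (x i) \<otimes> x j) / of_nat (card A))) \<in> \<real>\<^sub>\<ge>\<^sub>0"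
    if x: "\<forall>i<n. x i \<in> carrier G" for n :: nat and x c
  proof -
    define J where "J = {..<n} \<times> A"
    define v where "v = (\<lambda>(i, a). c i * cnj (\<theta> a))"
    define y where "y = (\<lambda>(i, a). x i \<otimes> f a)"
    \<comment> \<open>Up to the factor \<open>1 / sqrt (card A)\<close>, this is the coordinate at
      \<open>h\<close> of the combination, with coefficients \<open>c i\<close>, of the translates
      of the vector by \<open>x i\<close>. The quadratic form thus becomes a squared norm.\<close>
    define w where "w = (\<lambda>h. \<Sum>p\<in>J. if y p = h then v p else 0)"
    have yJ: "y p \<in> carrier G" if "p \<in> J" for p
      using that x fc by (auto simp: J_def y_def)
    have "(\<Sum>i<n. \<Sum>j<n. cnj (c i) * c j * ?S (inv (x i) \<otimes> x j)) =
        (\<Sum>i<n. \<Sum>j<n. \<Sum>b\<in>A. \<Sum>a\<in>A. cnj (v (i, b)) * v (j, a) * (if y (i, b) = y (j, a) then 1 else 0))"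
      unfolding sum_distrib_left
    proof (intro sum.cong refl)
      fix i j b a assume "i \<in> {..<n}" "j \<in> {..<n}" "b \<in> A" "a \<in> A"
      then have "inv (x i) \<otimes> x j \<otimes> f a = f b \<longleftrightarrow> y (i, b) = y (j, a)"
        using x fc by (auto simp: y_def m_assoc inv_solve_left')
      then show "cnj (c i) * c j * (if inv (x i) \<otimes> x j \<otimes> f a = f b then cnj (\<theta> a) * \<theta> b else 0) =
         cnj (v (i, b)) * v (j, a) * (if y (i, b) = y (j, a) then 1 else 0)"
        by (simp add: v_def)
    qed
    also have "\<dots> = (\<Sum>i<n. \<Sum>b\<in>A. \<Sum>j<n. \<Sum>a\<in>A. cnj (v (i, b)) * v (j, a) *
        (if y (i, b) = y (j, a) then 1 else 0))"
      by (intro sum.cong refl sum.swap)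
    also have "\<dots> = (\<Sum>p\<in>J. \<Sum>q\<in>J. cnj (v p) * v q * (if y p = y q then 1 else 0))"
      unfolding J_def by (simp only: sum.cartesian_product' fst_conv snd_conv)
    also have "\<dots> = (\<Sum>p\<in>J. \<Sum>q\<in>J. \<Sum>h\<in>carrier G.
        cnj (if y p = h then v p else 0) * (if y q = h then v q else 0))"
    proof (intro sum.cong refl)
      fix p q assume "p \<in> J" "q \<in> J"
      have "(\<Sum>h\<in>carrier G. cnj (if y p = h then v p else 0) * (if y q = h then v q else 0)) =
        (\<Sum>h\<in>carrier G. if h = y p then cnj (v p) * (if y q = y p then v q else 0) else 0)"
        by (intro sum.cong refl) auto
      then show "cnj (v p) * v q * (if y p = y q then 1 else 0) =
        (\<Sum>h\<in>carrier G. cnj (if y p = h then v p else 0) * (if y q = h then v q else 0))"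
        using yJ[OF \<open>p \<in> J\<close>] assms(1) by (auto simp: sum.delta)
    qed
    also have "\<dots> = (\<Sum>p\<in>J. \<Sum>h\<in>carrier G. \<Sum>q\<in>J.
        cnj (if y p = h then v p else 0) * (if y q = h then v q else 0))"
      by (intro sum.cong refl sum.swap)
    also have "\<dots> = (\<Sum>h\<in>carrier G. \<Sum>p\<in>J. \<Sum>q\<in>J.
        cnj (if y p = h then v p else 0) * (if y q = h then v q else 0))"
      by (rule sum.swap)
    also have "\<dots> = (\<Sum>h\<in>carrier G. cnj (w h) * w h)"
      by (simp only: w_def sum_product cnj_sum)
    also have "\<dots> = of_real (\<Sum>h\<in>carrier G. (cmod (w h))\<^sup>2)"
      unfolding of_real_sum by (intro sum.cong refl) (simp only: complex_norm_square mult.commute)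
    finally have "(\<Sum>i<n. \<Sum>j<n. cnj (c i) * c j * (?S (inv (x i) \<otimes> x j) / of_nat (card A))) =
        of_real (\<Sum>h\<in>carrier G. (cmod (w h))\<^sup>2) / of_nat (card A)"
      by (simp only: times_divide_eq_right flip: sum_divide_distrib)
    also have "\<dots> = of_real ((\<Sum>h\<in>carrier G. (cmod (w h))\<^sup>2) / real (card A))"
      by simp
    finally have eq: "(\<Sum>i<n. \<Sum>j<n. cnj (c i) * c j * (?S (inv (x i) \<otimes> x j) / of_nat (card A))) =
        of_real ((\<Sum>h\<in>carrier G. (cmod (w h))\<^sup>2) / real (card A))" .
    show ?thesis
      unfolding eq nonneg_Reals_of_real_iff by (intro divide_nonneg_nonneg sum_nonneg) auto
  qed
  moreover have "h \<otimes> g \<otimes> inv h = g" if "g \<in> carrier G" "h \<in> carrier G" for g h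
    using comm[of h g] that by (simp add: m_assoc)
  moreover have "?S \<one> / of_nat (card A) = 1"
  proof -
    have "?S \<one> = (\<Sum>b\<in>A. \<Sum>a\<in>A. if a = b then cnj (\<theta> b) * \<theta> b else 0)"
      using f(2) fc by (intro sum.cong refl) (auto simp: inj_on_def)
    also have "\<dots> = (\<Sum>b\<in>A. 1)"
    proof (intro sum.cong refl)
      fix b assume "b \<in> A"
      then have "cnj (\<theta> b) * \<theta> b = 1"
        using \<theta> by (simp flip: complex_norm_square add: mult.commute)
      then show "(\<Sum>a\<in>A. if a = b then cnj (\<theta> b) * \<theta> b else 0) = 1"
        using A \<open>b \<in> A\<close> by simp
    qed
    finally show ?thesis
      using A by simp
  qed
  ultimately show ?thesis
    unfolding group_character_def positive_definite_def by simp
qed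

end

section \<open>Approximation of extremal characters induced from the center\<close>

text \<open>On central elements of \<open>F\<close> an error of \<open>\<epsilon> / 3\<close> is
  spent on the Folner set and another on Krein-Milman in the quotient; at the noncentral elements of
  \<open>F\<close> the approximant vanishes exactly, as \<open>e\<close> does.\<close>

lemma (in group) center_induced_approximation:
  assumes "residually_finite G" and e: "extremal_character G e" and ind: "induced_from_center G e"
    and F: "finite F" "F \<subseteq> carrier G" and "\<epsilon> > 0"
  shows "\<exists>\<sigma>. trace_of_fd_rep G \<sigma> \<and> (\<forall>g\<in>F. cmod (\<sigma> g - e g) < \<epsilon>)"
proof -
  define Z where "Z = group_center G"
  define E where "E = F \<inter> Z"
  have Z_carrier: "z \<in> carrier G" if "z \<in> Z" for z
    using that by (simp add: Z_def group_center_def)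
  have E: "finite E" "E \<subseteq> group_center G"
    using F by (auto simp: E_def Z_def)
  have "\<epsilon> / 3 > 0"
    using \<open>\<epsilon> > 0\<close> by simp
  obtain A where A: "finite A" "A \<noteq> {}" "A \<subseteq> Z"
    and Folner: "\<And>z. z \<in> E \<Longrightarrow> real (card {a \<in> A. z \<otimes> a \<notin> A}) \<le> \<epsilon> / 3 * real (card A)"
    using center_Folner_set[OF E \<open>\<epsilon> / 3 > 0\<close>] unfolding Z_def by blast
  \<comment> \<open>Whether \<open>z a = b\<close> for \<open>z\<close> in \<open>E\<close> and
    \<open>a\<close>, \<open>b\<close> in \<open>A\<close> must be visible in the quotient, so
    injectivity is needed on the products as well as on \<open>A\<close>.\<close>
  define B where "B = A \<union> (\<lambda>(z, a). z \<otimes> a) ` (E \<times> A)"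
  have "B \<subseteq> carrier G"
    using A(3) E Z_carrier by (auto simp: B_def Z_def)
  \<comment> \<open>An element mapped into \<open>Q\<close> commutes in \<open>H\<close> with the
    whole image of \<open>G\<close>; a witness of noncommutation that survives in \<open>H\<close>
    excludes this.\<close>
  have "\<exists>h\<in>carrier G. g \<otimes> h \<noteq> h \<otimes> g" if "g \<in> F - Z" for g
    using that F(2) by (auto simp: Z_def group_center_def)
  then obtain c where c: "\<And>g. g \<in> F - Z \<Longrightarrow> c g \<in> carrier G \<and> g \<otimes> c g \<noteq> c g \<otimes> g"
    by metis
  define S where "S = {p \<in> B \<times> B. fst p \<noteq> snd p} \<union> (\<lambda>g. (g \<otimes> c g, c g \<otimes> g)) ` (F - Z)"
  have "finite S"
    using F A E by (auto simp: S_def B_def)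
  moreover have "x \<in> carrier G \<and> y \<in> carrier G \<and> x \<noteq> y" if "(x, y) \<in> S" for x y
    using that \<open>B \<subseteq> carrier G\<close> c F(2) by (auto simp: S_def)
  ultimately have "\<exists>(H :: nat monoid) \<phi>. group H \<and> finite (carrier H) \<and> \<phi> \<in> hom G H \<and>
      (\<forall>(x, y)\<in>S. \<phi> x \<noteq> \<phi> y)"
    by (rule residually_finite_separation[OF assms(1)])
  then obtain H :: "nat monoid" and \<phi> where H: "group H" "finite (carrier H)" and \<phi>: "\<phi> \<in> hom G H"
    and sep: "\<forall>(x, y)\<in>S. \<phi> x \<noteq> \<phi> y"
    by blast
  interpret H: group H
    by fact
  interpret \<phi>: group_hom G H \<phi>
    by (intro group_hom.intro group_hom_axioms.intro is_group H \<phi>)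
  have inj: "inj_on \<phi> B"
    using sep by (auto simp: S_def inj_on_def)
  define Q where "Q = \<phi> ` Z"
  have Q_comm: "q \<otimes>\<^bsub>H\<^esub> \<phi> g = \<phi> g \<otimes>\<^bsub>H\<^esub> q" if q: "q \<in> Q" and "g \<in> carrier G" for q g
  proof -
    obtain z where z: "z \<in> Z" "q = \<phi> z"
      using q by (auto simp: Q_def)
    then have "\<phi> (z \<otimes> g) = \<phi> (g \<otimes> z)"
      using group_center_commute[of z g] \<open>g \<in> carrier G\<close> by (simp only: Z_def)
    then show ?thesis
      using z Z_carrier \<open>g \<in> carrier G\<close> by simp
  qed
  have Q_notin: "\<phi> g \<notin> Q" if g: "g \<in> F - Z" for g
  proof
    assume "\<phi> g \<in> Q"
    then have "\<phi> (g \<otimes> c g) = \<phi> (c g \<otimes> g)"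
      using Q_comm[of "\<phi> g" "c g"] c[OF g] g F(2) by (simp add: subset_iff)
    moreover have "\<phi> (g \<otimes> c g) \<noteq> \<phi> (c g \<otimes> g)"
      using sep g by (auto simp: S_def)
    ultimately show False
      by simp
  qed
  have subgroup: "subgroup Q H"
  proof -
    have "subgroup Z G"
    proof (rule subgroupI)
      show "a \<otimes> b \<in> Z" if "a \<in> Z" "b \<in> Z" for a b
        using that unfolding Z_def by (rule mult_in_group_center)
      show "Z \<subseteq> carrier G"
        using Z_carrier by blast
      have "\<one> \<in> Z"
        by (simp add: Z_def group_center_def)
      then show "Z \<noteq> {}"
        by blast
      show "inv a \<in> Z" if "a \<in> Z" for a
        using that unfolding Z_def by (rule inv_in_group_center)
    qed
    then show ?thesis
      unfolding Q_def by (rule \<phi>.subgroup_img_is_subgroup)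
  qed
  define P where "P = H\<lparr>carrier := Q\<rparr>"
  have P: "group P"
    unfolding P_def by (rule subgroup.subgroup_is_group[OF subgroup H(1)])
  interpret P: group P
    by fact
  have P_simps: "carrier P = Q" "\<one>\<^bsub>P\<^esub> = \<one>\<^bsub>H\<^esub>" "x \<otimes>\<^bsub>P\<^esub> y = x \<otimes>\<^bsub>H\<^esub> y" for x y
    by (simp_all add: P_def)
  have "finite Q"
    using finite_subset[OF subgroup.subset[OF subgroup] H(2)] .
  have P_comm: "x \<otimes>\<^bsub>P\<^esub> y = y \<otimes>\<^bsub>P\<^esub> x" if "x \<in> carrier P" "y \<in> carrier P" for x y
    using that Q_comm Z_carrier unfolding P_simps Q_def by blast
  then have P_center: "group_center P = Q"
    by (auto simp: group_center_def P_simps(1))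

  define ext where "ext = (\<lambda>\<psi> g. if \<phi> g \<in> Q then \<psi> (\<phi> g) else (0::complex))"
  \<comment> \<open>The abelian group \<open>P\<close> is its own center, so the results on the
    center turn \<open>\<eta>\<close> into a homomorphism to the circle. The preimage of
    \<open>Q\<close> has finite index because the image of \<open>\<phi>\<close> is finite.\<close>
  have extremal_P: "trace_of_fd_rep G (ext \<eta>)" if \<eta>: "extremal_character P \<eta>" for \<eta>
  proof (rule trace_of_fd_rep_of_multiplicative[where \<phi> = \<phi>, OF is_group])
    have \<eta>_one: "\<eta> \<one>\<^bsub>H\<^esub> = 1"
      using \<eta> by (simp add: extremal_character_def group_character_def P_simps)
    have one_Q: "\<one>\<^bsub>H\<^esub> \<in> Q"
      by (rule subgroup.one_closed[OF subgroup])
    show "ext \<eta> \<one> = 1"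
      using \<eta>_one one_Q by (simp add: ext_def)
    show "ext \<eta> (g \<otimes> h) = ext \<eta> g * ext \<eta> h"
      if "g \<in> carrier G" "h \<in> carrier G" "ext \<eta> g \<noteq> 0" for g h
    proof -
      have g: "\<phi> g \<in> Q"
        using that(3) by (auto simp: ext_def split: if_splits)
      show ?thesis
      proof (cases "\<phi> h \<in> Q")
        case True
        then show ?thesis
          using P.extremal_character_center_mult[OF \<eta>, of "\<phi> g" "\<phi> h"] g that(1,2)
            subgroup.m_closed[OF subgroup g True]
          by (simp add: ext_def P_center P_simps)
      next
        case False
        have "\<phi> g \<otimes>\<^bsub>H\<^esub> \<phi> h \<notin> Q"
        proof
          assume "\<phi> g \<otimes>\<^bsub>H\<^esub> \<phi> h \<in> Q"
          then have "inv\<^bsub>H\<^esub> \<phi> g \<otimes>\<^bsub>H\<^esub> (\<phi> g \<otimes>\<^bsub>H\<^esub> \<phi> h) \<in> Q"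
            by (rule subgroup.m_closed[OF subgroup subgroup.m_inv_closed[OF subgroup g]])
          moreover have "inv\<^bsub>H\<^esub> \<phi> g \<otimes>\<^bsub>H\<^esub> (\<phi> g \<otimes>\<^bsub>H\<^esub> \<phi> h) = \<phi> h"
            using that(1,2) by (simp add: H.m_assoc[symmetric] del: \<phi>.hom_mult)
          ultimately show False
            using False by simp
        qed
        then show ?thesis
          using False that(1,2) by (simp add: ext_def)
      qed
    qed
    show "cmod (ext \<eta> g) = 1" if "g \<in> carrier G" "ext \<eta> g \<noteq> 0" for g
      using P.extremal_character_center_norm[OF \<eta>, of "\<phi> g"] that(2)
      by (simp add: ext_def P_center split: if_splits)
    show "ext \<eta> (h \<otimes> g \<otimes> inv h) = ext \<eta> g" if gh: "g \<in> carrier G" "h \<in> carrier G" for g h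
    proof -
      have conj: "\<phi> (h \<otimes> g \<otimes> inv h) = \<phi> g" if "\<phi> g \<in> Q" "g \<in> carrier G" "h \<in> carrier G" for g h
      proof -
        have "\<phi> (h \<otimes> g \<otimes> inv h) = \<phi> h \<otimes>\<^bsub>H\<^esub> \<phi> g \<otimes>\<^bsub>H\<^esub> inv\<^bsub>H\<^esub> \<phi> h"
          using that(2,3) by simp
        also have "\<phi> h \<otimes>\<^bsub>H\<^esub> \<phi> g = \<phi> g \<otimes>\<^bsub>H\<^esub> \<phi> h"
          by (rule Q_comm[OF that(1,3), symmetric])
        also have "\<phi> g \<otimes>\<^bsub>H\<^esub> \<phi> h \<otimes>\<^bsub>H\<^esub> inv\<^bsub>H\<^esub> \<phi> h = \<phi> g"
          using that(2,3) by (simp add: H.m_assoc)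
        finally show ?thesis .
      qed
      \<comment> \<open>Undoing the conjugation is again a conjugation, now of an element that maps
        into \<open>Q\<close>, where \<open>conj\<close> applies.\<close>
      have conj_back: "\<phi> g \<in> Q" if Q: "\<phi> (h \<otimes> g \<otimes> inv h) \<in> Q"
      proof -
        have eq: "inv h \<otimes> (h \<otimes> g \<otimes> inv h) \<otimes> inv (inv h) = g"
          using gh by (simp add: m_assoc) (simp add: m_assoc[symmetric])
        have "\<phi> (inv h \<otimes> (h \<otimes> g \<otimes> inv h) \<otimes> inv (inv h)) = \<phi> (h \<otimes> g \<otimes> inv h)"
          by (rule conj[OF Q]) (use gh in auto)
        then show ?thesis
          using Q unfolding eq by simp
      qed
      show ?thesis
      proof (cases "\<phi> g \<in> Q")
        case True
        show ?thesis
          unfolding ext_def conj[OF True gh] ..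
      next
        case False
        then have "\<phi> (h \<otimes> g \<otimes> inv h) \<notin> Q"
          using conj_back by blast
        then show ?thesis
          unfolding ext_def using False by (simp only: if_False)
      qed
    qed
    show "finite (\<phi> ` carrier G)"
      by (rule finite_subset[OF _ H(2)]) auto
    show "ext \<eta> (inv g \<otimes> h) \<noteq> 0" if "g \<in> carrier G" "h \<in> carrier G" "\<phi> g = \<phi> h" for g h
      using that \<eta>_one one_Q by (simp add: ext_def)
  qed

  have e_norm: "cmod (e a) = 1" if "a \<in> Z" for a
    using extremal_character_center_norm[OF e] that by (simp add: Z_def)
  \<comment> \<open>At \<open>\<phi> z\<close> with \<open>z\<close> in \<open>E\<close>, only the
    pairs with \<open>b = z a\<close> survive, each contributing
    \<open>cnj (e a) * e (z a) = e z\<close>. The value is \<open>e z\<close> times the proportion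
    of \<open>A\<close> that translation by \<open>z\<close> keeps inside \<open>A\<close>.\<close>
  define \<Psi> where "\<Psi> = (\<lambda>q. (\<Sum>b\<in>A. \<Sum>a\<in>A. if q \<otimes>\<^bsub>P\<^esub> \<phi> a = \<phi> b then cnj (e a) * e b else 0) / of_nat (card A))"
  have "inj_on \<phi> A"
    using inj by (rule inj_on_subset) (auto simp: B_def)
  moreover have "\<phi> ` A \<subseteq> carrier P"
    using A(3) by (auto simp: P_simps Q_def)
  ultimately have \<Psi>: "group_character P \<Psi>"
    unfolding \<Psi>_def using A e_norm \<open>finite Q\<close> P_comm
    by (intro P.group_character_of_vector) (auto simp: P_simps(1))
  have \<Psi>_approx: "cmod (\<Psi> (\<phi> z) - e z) \<le> \<epsilon> / 3" if z: "z \<in> E" for z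
  proof -
    have zZ: "z \<in> Z"
      using z by (simp add: E_def)
    have "\<Psi> (\<phi> z) = (\<Sum>b\<in>A. \<Sum>a\<in>A. if z \<otimes> a = b then cnj (e a) * e b else 0) / of_nat (card A)"
      unfolding \<Psi>_def
    proof (intro arg_cong2[where f = "(/)"] sum.cong refl if_cong)
      fix a b assume ab: "a \<in> A" "b \<in> A"
      then have "z \<otimes> a \<in> B" "b \<in> B" "a \<in> carrier G" "z \<in> carrier G"
        using z zZ A(3) Z_carrier by (auto simp: B_def)
      then show "(\<phi> z \<otimes>\<^bsub>P\<^esub> \<phi> a = \<phi> b) = (z \<otimes> a = b)"
        using inj by (simp add: P_simps inj_on_eq_iff flip: \<phi>.hom_mult)
    qed
    also have "(\<Sum>b\<in>A. \<Sum>a\<in>A. if z \<otimes> a = b then cnj (e a) * e b else 0) =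
        (\<Sum>a\<in>A. \<Sum>b\<in>A. if z \<otimes> a = b then cnj (e a) * e b else 0)"
      by (rule sum.swap)
    also have "\<dots> = (\<Sum>a\<in>A. e z - (if z \<otimes> a \<notin> A then e z else 0))"
    proof (intro sum.cong refl)
      fix a assume a: "a \<in> A"
      then have "cnj (e a) * e a = 1"
        using e_norm[of a] A(3) by (auto simp: mult.commute simp flip: complex_norm_square)
      moreover have "e (z \<otimes> a) = e z * e a"
        using extremal_character_center_mult[OF e] zZ a A(3) Z_carrier by (auto simp: Z_def)
      ultimately show "(\<Sum>b\<in>A. if z \<otimes> a = b then cnj (e a) * e b else 0) =
          e z - (if z \<otimes> a \<notin> A then e z else 0)"
        using A(1) by (simp add: sum.delta' algebra_simps)
    qed
    also have "\<dots> = of_nat (card A) * e z - of_nat (card {a \<in> A. z \<otimes> a \<notin> A}) * e z"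
      using A(1) by (simp add: sum_subtractf sum.If_cases Int_def)
    finally have "\<Psi> (\<phi> z) - e z = - (of_nat (card {a \<in> A. z \<otimes> a \<notin> A}) / of_nat (card A)) * e z"
      using A(1,2) by (simp add: field_simps)
    then have "cmod (\<Psi> (\<phi> z) - e z) = real (card {a \<in> A. z \<otimes> a \<notin> A}) / real (card A)"
      using e_norm[OF zZ] by (simp add: norm_mult norm_divide)
    also have "\<dots> \<le> \<epsilon> / 3"
      using Folner[OF z] A(1,2) by (simp add: divide_le_eq card_gt_0_iff)
    finally show ?thesis .
  qed

  have "\<exists>\<psi>. trace_of_fd_rep G (ext \<psi>) \<and> (\<forall>q\<in>\<phi> ` E. cmod (\<psi> q - \<Psi> q) < \<epsilon> / 3)"
  \<comment> \<open>The class consists of functions on \<open>Q\<close> whose extension is a trace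
    on \<open>G\<close>, so that the approximant found in the quotient is already one on
    \<open>G\<close>. Every extremal character of \<open>P\<close> belongs to the class and
    approximates itself.\<close>
  proof (rule character_approximation[where T = "\<lambda>\<psi>. trace_of_fd_rep G (ext \<psi>)", OF P _ _ _ _ \<Psi>])
    show "countable (carrier P)"
      using \<open>finite Q\<close> by (simp add: P_simps countable_finite)
    show "trace_of_fd_rep G (ext (\<lambda>g. (\<sigma>1 g + \<sigma>2 g) / 2))"
      if "trace_of_fd_rep G (ext \<sigma>1)" "trace_of_fd_rep G (ext \<sigma>2)" for \<sigma>1 \<sigma>2
    proof -
      have "ext (\<lambda>g. (\<sigma>1 g + \<sigma>2 g) / 2) = (\<lambda>g. (ext \<sigma>1 g + ext \<sigma>2 g) / 2)"
        by (auto simp: ext_def)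
      then show ?thesis
        using trace_of_fd_rep_midpoint[OF is_group that] by simp
    qed
    show "cmod (\<sigma> q) \<le> 1" if \<sigma>: "trace_of_fd_rep G (ext \<sigma>)" and q: "q \<in> carrier P" for \<sigma> q
    proof -
      obtain z where "z \<in> Z" "q = \<phi> z"
        using q by (auto simp: P_simps Q_def)
      then show ?thesis
        using trace_of_fd_rep_norm_le_one[OF is_group \<sigma>, of z] q Z_carrier
        by (simp add: ext_def P_simps)
    qed
    show "\<exists>\<sigma>. trace_of_fd_rep G (ext \<sigma>) \<and> (\<forall>g\<in>F. cmod (\<sigma> g - \<eta> g) < \<delta>)"
      if "extremal_character P \<eta>" "0 < \<delta>" for \<eta> F \<delta>
      using extremal_P[OF that(1)] that(2) by (intro exI[of _ \<eta>]) simp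
  qed (use E \<open>\<epsilon> > 0\<close> in \<open>auto simp: P_simps Q_def Z_def\<close>)
  then obtain \<psi> where \<psi>: "trace_of_fd_rep G (ext \<psi>)"
    and \<psi>_approx: "\<And>z. z \<in> E \<Longrightarrow> cmod (\<psi> (\<phi> z) - \<Psi> (\<phi> z)) < \<epsilon> / 3"
    by blast
  have "cmod (ext \<psi> g - e g) < \<epsilon>" if g: "g \<in> F" for g
  proof (cases "g \<in> Z")
    case True
    then have "g \<in> E"
      using g by (simp add: E_def)
    have "cmod (\<psi> (\<phi> g) - e g) \<le> cmod (\<psi> (\<phi> g) - \<Psi> (\<phi> g)) + cmod (\<Psi> (\<phi> g) - e g)"
      using norm_triangle_ineq[of "\<psi> (\<phi> g) - \<Psi> (\<phi> g)" "\<Psi> (\<phi> g) - e g"] by simp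
    then show ?thesis
      using \<psi>_approx[OF \<open>g \<in> E\<close>] \<Psi>_approx[OF \<open>g \<in> E\<close>] \<open>\<epsilon> > 0\<close> True
      by (simp add: ext_def Q_def)
  next
    case False
    then have "e g = 0"
      using ind g F(2) by (auto simp: induced_from_center_def Z_def)
    then show ?thesis
      using Q_notin[of g] g False \<open>\<epsilon> > 0\<close> by (simp add: ext_def)
  qed
  then show ?thesis
    using \<psi> by blast
qed

theorem corollary1:
  fixes G :: "('a, 'b) monoid_scheme"
  assumes "group G"
    and "countable (carrier G)"
    and "residually_finite G"
    and "character_rigidity G"
  shows "approximation_property G"
  unfolding approximation_property_def
proof (intro allI impI)
  interpret group G by fact
  fix \<tau> assume "embeddable_character G \<tau>"
  then have \<tau>: "group_character G \<tau>"
    by (simp add: embeddable_character_def)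
  have approx: "\<exists>\<sigma>. trace_of_fd_rep G \<sigma> \<and> (\<forall>g\<in>F. cmod (\<sigma> g - \<tau> g) < \<epsilon>)"
    if "finite F" "F \<subseteq> carrier G" "\<epsilon> > 0" for F \<epsilon>
  proof (rule character_approximation[OF assms(1,2) _ _ _ \<tau> that])
    show "\<exists>\<sigma>. trace_of_fd_rep G \<sigma> \<and> (\<forall>g\<in>F. cmod (\<sigma> g - e g) < \<epsilon>)"
      if "extremal_character G e" "finite F" "F \<subseteq> carrier G" "\<epsilon> > 0" for e F \<epsilon>
    proof (cases "induced_from_center G e")
      case True
      then show ?thesis
        using center_induced_approximation[OF assms(3) that(1)] that by blast
    next
      case False
      then have "trace_of_fd_rep G e"
        using assms(4) that(1) by (simp add: character_rigidity_def)
      then show ?thesis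
        using that(4) by (intro exI[of _ e]) simp
    qed
    show "trace_of_fd_rep G (\<lambda>g. (\<sigma>1 g + \<sigma>2 g) / 2)"
      if "trace_of_fd_rep G \<sigma>1" "trace_of_fd_rep G \<sigma>2" for \<sigma>1 \<sigma>2
      by (rule trace_of_fd_rep_midpoint[OF assms(1) that])
    show "cmod (\<sigma> g) \<le> 1" if "trace_of_fd_rep G \<sigma>" "g \<in> carrier G" for \<sigma> g
      by (rule trace_of_fd_rep_norm_le_one[OF assms(1) that])
  qed
  define x where "x = from_nat_into (carrier G)"
  have x: "x n \<in> carrier G" for n
    unfolding x_def by (rule from_nat_into) auto
  \<comment> \<open>The finite sets exhaust the carrier while the tolerance \<open>1 / Suc k\<close>
    shrinks, so each point is controlled from its index on; this turns approximation on finite sets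
    into one convergent sequence.\<close>
  have "\<exists>\<sigma>. trace_of_fd_rep G \<sigma> \<and> (\<forall>g\<in>x ` {..k}. cmod (\<sigma> g - \<tau> g) < 1 / Suc k)" for k
    using x by (intro approx) auto
  then have "\<exists>\<sigma>. \<forall>k. trace_of_fd_rep G (\<sigma> k) \<and> (\<forall>g\<in>x ` {..k}. cmod (\<sigma> k g - \<tau> g) < 1 / Suc k)"
    by (intro choice allI)
  then obtain \<sigma> where \<sigma>: "\<And>k. trace_of_fd_rep G (\<sigma> k)"
    "\<And>k g. g \<in> x ` {..k} \<Longrightarrow> cmod (\<sigma> k g - \<tau> g) < 1 / Suc k"
    by blast
  have "(\<lambda>k. \<sigma> k g) \<longlonglongrightarrow> \<tau> g" if g: "g \<in> carrier G" for g
  proof -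
    obtain n where "g = x n"
      using from_nat_into_surj[OF assms(2) g] by (auto simp: x_def)
    then have "norm (\<sigma> k g - \<tau> g) \<le> 1 / real (Suc k)" if "n \<le> k" for k
      using \<sigma>(2)[OF image_eqI[of g x n "{..k}"]] that by (simp add: less_imp_le)
    then have "eventually (\<lambda>k. norm (\<sigma> k g - \<tau> g) \<le> 1 / real (Suc k)) sequentially"
      by (rule eventually_sequentiallyI)
    moreover have "(\<lambda>k. 1 / real (Suc k)) \<longlonglongrightarrow> 0"
      using LIMSEQ_inverse_real_of_nat by (simp add: inverse_eq_divide)
    ultimately have "(\<lambda>k. \<sigma> k g - \<tau> g) \<longlonglongrightarrow> 0"
      by (rule Lim_null_comparison)
    then show ?thesis
      by (simp add: LIM_zero_iff)
  qed
  then show "\<exists>\<sigma>. (\<forall>k. trace_of_fd_rep G (\<sigma> k)) \<and> (\<forall>g\<in>carrier G. (\<lambda>k. \<sigma> k g) \<longlonglongrightarrow> \<tau> g)"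
    using \<sigma>(1) by blast
qed

end
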